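(* Let $\mu,\sigma,M>0$, $c\in(0,1)$, $\omega_1,\omega_2>0$ with $\omega_1+\omega_2=1$, $0<\delta_1<\delta_2$, and $\beta(t)=\sum_{i=1}^2\omega_i\mathrm{e}^{-\delta_it}$. Suppose there exist $0<x_1<x_2$ such that, with the constants $A_{i,j}=A_{i,j}(x_1,x_2)$ and $\theta_{i,j}$ defined in the context, $$\sum_{i=1}^2\omega_i\big(A_{i,1}\theta_{i,1}\mathrm{e}^{\theta_{i,1}x_1}-A_{i,2}\theta_{i,2}\mathrm{e}^{-\theta_{i,2}x_1}\big)=-1,\qquad \sum_{i=1}^2\omega_i\big(A_{i,3}\theta_{i,3}^2\mathrm{e}^{\theta_{i,3}x_2}+A_{i,4}\theta_{i,4}^2\mathrm{e}^{-\theta_{i,4}x_2}\big)=0.$$ Then, with $V_1,V_2$ as defined in the context for these $x_1,x_2$, the functions $$f(x,t,s)=\sum_{i=1}^2\omega_i\mathrm{e}^{-\delta_i(t-s)}V_i(x)\quad(x\ge0,\ t\ge0,\ s\in[0,t]),\qquad V(x)=\sum_{i=1}^2\omega_iV_i(x)\quad(x\ge0)$$ are a solution to the extended HJB system (stated in the context) under the discount function $\beta$. In addition, $V$ is decreasing and convex on $[0,+\infty)$.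
   Context: **Constants.** For $i=1,2$: $\theta_{i,1}=\frac{-(\mu+M)+\sqrt{(\mu+M)^2+2\delta_i\sigma^2}}{\sigma^2}$, $\theta_{i,2}=\frac{\mu+M+\sqrt{(\mu+M)^2+2\delta_i\sigma^2}}{\sigma^2}$, $\theta_{i,3}=\frac{-\mu+\sqrt{\mu^2+2\delta_i\sigma^2}}{\sigma^2}$, $\theta_{i,4}=\frac{\mu+\sqrt{\mu^2+2\delta_i\sigma^2}}{\sigma^2}$. **The functions $V_i$.** For $0<x_1<x_2$, $V_i(x)=\frac{M}{\delta_i}+A_{i,1}\mathrm{e}^{\theta_{i,1}x}+A_{i,2}\mathrm{e}^{-\theta_{i,2}x}$ for $x\in[0,x_1)$; $V_i(x)=A_{i,3}\mathrm{e}^{\theta_{i,3}x}+A_{i,4}\mathrm{e}^{-\theta_{i,4}x}$ for $x\in[x_1,x_2)$; $V_i(x)=-cx+A_{i,5}$ for $x\ge x_2$; where $A_{i,1},\dots,A_{i,5}$ are the constants (uniquely) determined by the linear system expressing $V_i(0)=0$ and continuity of $V_i$ and $V_i'$ at $x_1$ and $x_2$: $\frac{M}{\delta_i}+A_{i,1}+A_{i,2}=0$; $\frac{M}{\delta_i}+A_{i,1}\mathrm{e}^{\theta_{i,1}x_1}+A_{i,2}\mathrm{e}^{-\theta_{i,2}x_1}=A_{i,3}\mathrm{e}^{\theta_{i,3}x_1}+A_{i,4}\mathrm{e}^{-\theta_{i,4}x_1}$; $A_{i,1}\theta_{i,1}\mathrm{e}^{\theta_{i,1}x_1}-A_{i,2}\theta_{i,2}\mathrm{e}^{-\theta_{i,2}x_1}=A_{i,3}\theta_{i,3}\mathrm{e}^{\theta_{i,3}x_1}-A_{i,4}\theta_{i,4}\mathrm{e}^{-\theta_{i,4}x_1}$;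 $A_{i,3}\mathrm{e}^{\theta_{i,3}x_2}+A_{i,4}\mathrm{e}^{-\theta_{i,4}x_2}=-cx_2+A_{i,5}$; $A_{i,3}\theta_{i,3}\mathrm{e}^{\theta_{i,3}x_2}-A_{i,4}\theta_{i,4}\mathrm{e}^{-\theta_{i,4}x_2}=-c$. **Extended HJB system.** Let $\tilde{\mathcal{Q}}=[0,\infty)^2$ (points $(x,t)$), and regard $V(x)$ as $V(x,t)$ independent of $t$. Let $\hat\Pi(x,t)=M$ for $0\le x<x_1$ and $\hat\Pi(x,t)=0$ for $x\ge x_1$; $W:=\{(x,t)\in\tilde{\mathcal{Q}}:-c-V_x(x,t)>0\}$, $P:=\{(x,t)\in\tilde{\mathcal{Q}}:-c-V_x(x,t)=0\}$. The system consists of: - $\hat\Pi(x,t)\in\operatorname{argmin}_{u\in[0,M]}\{V_t(x,t)+(\mu+u)V_x(x,t)+\frac12\sigma^2V_{xx}(x,t)+u-f_s(x,t,t)\}$ for all $(x,t)\in\tilde{\mathcal{Q}}$; - $\min\{V_t+(\mu+\hat\Pi)V_x+\frac12\sigma^2V_{xx}+\hat\Pi-f_s(x,t,t),\ -c-V_x\}=0$ for all $(x,t)\in\tilde{\mathcal{Q}}$, and $V(0,t)=0$; - $f_t(x,t,s)+(\mu+\hat\Pi(x,t))f_x(x,t,s)+\frac12\sigma^2f_{xx}(x,t,s)+\beta(t-s)\hat\Pi(x,t)=0$ for $(x,t)\in\overline{W}$, $s\in[0,t]$; - $-\beta(t-s)c-f_x(x,t,s)=0$ for $(x,t)\in P$,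 $s\in[0,t]$, and $f(0,t,s)=0$. Convention: $f$ is $C^1$ but $f_{xx}$ may jump at $x_1,x_2$; at $x=x_1$ use $f_{xx}(x_1+,t,s)$ and at $x=x_2$ use $f_{xx}(x_2-,t,s)$. Derivatives at $x=0$ are one-sided. *)

theory Defs
  imports "HOL-Analysis.Analysis"
begin

definition theta :: "real \<Rightarrow> real \<Rightarrow> real \<Rightarrow> real \<Rightarrow> nat \<Rightarrow> real" where
  "theta \<mu> \<sigma> M \<delta> j =
     (if j = 1 then (- (\<mu> + M) + sqrt ((\<mu> + M)\<^sup>2 + 2 * \<delta> * \<sigma>\<^sup>2)) / \<sigma>\<^sup>2
      else if j = 2 then (\<mu> + M + sqrt ((\<mu> + M)\<^sup>2 + 2 * \<delta> * \<sigma>\<^sup>2)) / \<sigma>\<^sup>2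
      else if j = 3 then (- \<mu> + sqrt (\<mu>\<^sup>2 + 2 * \<delta> * \<sigma>\<^sup>2)) / \<sigma>\<^sup>2
      else if j = 4 then (\<mu> + sqrt (\<mu>\<^sup>2 + 2 * \<delta> * \<sigma>\<^sup>2)) / \<sigma>\<^sup>2
      else 0)"

definition coeff_system ::
  "real \<Rightarrow> real \<Rightarrow> real \<Rightarrow> real \<Rightarrow> real \<Rightarrow> real \<Rightarrow> real \<Rightarrow> (nat \<Rightarrow> real) \<Rightarrow> bool" where
  "coeff_system \<mu> \<sigma> M c \<delta> x1 x2 A \<longleftrightarrow>
     (let \<theta> = theta \<mu> \<sigma> M \<delta> in
        M / \<delta> + A 1 + A 2 = 0 \<and>
        M / \<delta> + A 1 * exp (\<theta> 1 * x1) + A 2 * exp (- \<theta> 2 * x1)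
          = A 3 * exp (\<theta> 3 * x1) + A 4 * exp (- \<theta> 4 * x1) \<and>
        A 1 * \<theta> 1 * exp (\<theta> 1 * x1) - A 2 * \<theta> 2 * exp (- \<theta> 2 * x1)
          = A 3 * \<theta> 3 * exp (\<theta> 3 * x1) - A 4 * \<theta> 4 * exp (- \<theta> 4 * x1) \<and>
        A 3 * exp (\<theta> 3 * x2) + A 4 * exp (- \<theta> 4 * x2) = - c * x2 + A 5 \<and>
        A 3 * \<theta> 3 * exp (\<theta> 3 * x2) - A 4 * \<theta> 4 * exp (- \<theta> 4 * x2) = - c)"

(* The coefficients are indexed by 1..5; fixing the value 0 at all other indices
   makes the solution unique as a function on nat. *)
definition A_coeff ::
  "real \<Rightarrow> real \<Rightarrow> real \<Rightarrow> real \<Rightarrow> real \<Rightarrow> real \<Rightarrow> real \<Rightarrow> nat \<Rightarrow> real" where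
  "A_coeff \<mu> \<sigma> M c \<delta> x1 x2 =
     (THE A. coeff_system \<mu> \<sigma> M c \<delta> x1 x2 A \<and> (\<forall>j. j \<notin> {1..5} \<longrightarrow> A j = 0))"

definition V_comp ::
  "real \<Rightarrow> real \<Rightarrow> real \<Rightarrow> real \<Rightarrow> real \<Rightarrow> real \<Rightarrow> real \<Rightarrow> real \<Rightarrow> real" where
  "V_comp \<mu> \<sigma> M c \<delta> x1 x2 x =
     (let A = A_coeff \<mu> \<sigma> M c \<delta> x1 x2; \<theta> = theta \<mu> \<sigma> M \<delta> in
        if x < x1 then M / \<delta> + A 1 * exp (\<theta> 1 * x) + A 2 * exp (- \<theta> 2 * x)
        else if x < x2 then A 3 * exp (\<theta> 3 * x) + A 4 * exp (- \<theta> 4 * x)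
        else - c * x + A 5)"

definition Pi_hat :: "real \<Rightarrow> real \<Rightarrow> real \<Rightarrow> real \<Rightarrow> real" where
  "Pi_hat M x1 x t = (if x < x1 then M else 0)"

definition state_dom :: "(real \<times> real) set" where
  "state_dom = {(x, t). 0 \<le> x \<and> 0 \<le> t}"

definition f_dom :: "(real \<times> real \<times> real) set" where
  "f_dom = {(x, t, s). 0 \<le> x \<and> 0 \<le> s \<and> s \<le> t}"

(* Vt, Vx, Vxx are the partial derivatives of a function V that is twice continuously
   differentiable in x and continuously differentiable in t, one-sided on the boundary. *)
definition V_derivs ::
  "(real \<Rightarrow> real \<Rightarrow> real) \<Rightarrow> (real \<Rightarrow> real \<Rightarrow> real) \<Rightarrow> (real \<Rightarrow> real \<Rightarrow> real) \<Rightarrow>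
   (real \<Rightarrow> real \<Rightarrow> real) \<Rightarrow> bool" where
  "V_derivs V Vt Vx Vxx \<longleftrightarrow>
     continuous_on state_dom (\<lambda>(x, t). V x t) \<and>
     continuous_on state_dom (\<lambda>(x, t). Vt x t) \<and>
     continuous_on state_dom (\<lambda>(x, t). Vx x t) \<and>
     continuous_on state_dom (\<lambda>(x, t). Vxx x t) \<and>
     (\<forall>(x, t) \<in> state_dom.
        ((\<lambda>r. V x r) has_real_derivative Vt x t) (at t within {0..}) \<and>
        ((\<lambda>y. V y t) has_real_derivative Vx x t) (at x within {0..}) \<and>
        ((\<lambda>y. Vx y t) has_real_derivative Vxx x t) (at x within {0..}))"

(* f is continuously differentiable on f_dom with partial derivatives ft, fx, fs, taken
   along the slices of f_dom.  For t = 0 the slice in s is the single point 0, where the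
   condition on fs is void; there fs is determined by its continuity on f_dom.
   The second derivative fxx may jump at x1 and x2: continuity on the middle slab
   says that its values there are the one-sided limits fxx(x1+) and fxx(x2-). *)
definition f_derivs ::
  "real \<Rightarrow> real \<Rightarrow> (real \<Rightarrow> real \<Rightarrow> real \<Rightarrow> real) \<Rightarrow> (real \<Rightarrow> real \<Rightarrow> real \<Rightarrow> real) \<Rightarrow>
   (real \<Rightarrow> real \<Rightarrow> real \<Rightarrow> real) \<Rightarrow> (real \<Rightarrow> real \<Rightarrow> real \<Rightarrow> real) \<Rightarrow>
   (real \<Rightarrow> real \<Rightarrow> real \<Rightarrow> real) \<Rightarrow> bool" where
  "f_derivs x1 x2 f ft fs fx fxx \<longleftrightarrow>
     continuous_on f_dom (\<lambda>(x, t, s). f x t s) \<and>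
     continuous_on f_dom (\<lambda>(x, t, s). ft x t s) \<and>
     continuous_on f_dom (\<lambda>(x, t, s). fs x t s) \<and>
     continuous_on f_dom (\<lambda>(x, t, s). fx x t s) \<and>
     (\<forall>(x, t, s) \<in> f_dom.
        ((\<lambda>r. f x r s) has_real_derivative ft x t s) (at t within {s..}) \<and>
        ((\<lambda>r. f x t r) has_real_derivative fs x t s) (at s within {0..t}) \<and>
        ((\<lambda>y. f y t s) has_real_derivative fx x t s) (at x within {0..}) \<and>
        (x \<noteq> x1 \<and> x \<noteq> x2 \<longrightarrow>
           ((\<lambda>y. fx y t s) has_real_derivative fxx x t s) (at x within {0..}))) \<and>
     continuous_on (f_dom \<inter> {(x, t, s). x < x1}) (\<lambda>(x, t, s). fxx x t s) \<and>
     continuous_on (f_dom \<inter> {(x, t, s). x1 \<le> x \<and> x \<le> x2}) (\<lambda>(x, t, s). fxx x t s) \<and>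
     continuous_on (f_dom \<inter> {(x, t, s). x2 < x}) (\<lambda>(x, t, s). fxx x t s) \<and>
     (\<forall>t s. 0 \<le> s \<and> s \<le> t \<longrightarrow>
        (\<exists>l. ((\<lambda>y. fxx y t s) \<longlongrightarrow> l) (at_left x1)) \<and>
        (\<exists>l. ((\<lambda>y. fxx y t s) \<longlongrightarrow> l) (at_right x2)))"

(* The derivative functions below are uniquely determined by f and V on the relevant
   domains, so the existential quantifiers only assert the regularity of f and V. *)
definition extended_HJB_solution ::
  "real \<Rightarrow> real \<Rightarrow> real \<Rightarrow> real \<Rightarrow> (real \<Rightarrow> real) \<Rightarrow> real \<Rightarrow> real \<Rightarrow>
   (real \<Rightarrow> real \<Rightarrow> real \<Rightarrow> real) \<Rightarrow> (real \<Rightarrow> real \<Rightarrow> real) \<Rightarrow> bool" where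
  "extended_HJB_solution \<mu> \<sigma> M c \<beta> x1 x2 f V \<longleftrightarrow>
     (\<exists>Vt Vx Vxx ft fs fx fxx.
        V_derivs V Vt Vx Vxx \<and> f_derivs x1 x2 f ft fs fx fxx \<and>
        (let \<pi> = Pi_hat M x1;
             W = {(x, t). (x, t) \<in> state_dom \<and> - c - Vx x t > 0};
             P = {(x, t). (x, t) \<in> state_dom \<and> - c - Vx x t = 0}
         in
           (\<forall>(x, t) \<in> state_dom.
              is_arg_min
                (\<lambda>u. Vt x t + (\<mu> + u) * Vx x t + 1 / 2 * \<sigma>\<^sup>2 * Vxx x t + u - fs x t t)
                (\<lambda>u. u \<in> {0..M}) (\<pi> x t)) \<and>
           (\<forall>(x, t) \<in> state_dom.
              min (Vt x t + (\<mu> + \<pi> x t) * Vx x t + 1 / 2 * \<sigma>\<^sup>2 * Vxx x t + \<pi> x t - fs x t t)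
                  (- c - Vx x t) = 0) \<and>
           (\<forall>t\<ge>0. V 0 t = 0) \<and>
           (\<forall>(x, t) \<in> closure W. \<forall>s\<in>{0..t}.
              ft x t s + (\<mu> + \<pi> x t) * fx x t s + 1 / 2 * \<sigma>\<^sup>2 * fxx x t s
                + \<beta> (t - s) * \<pi> x t = 0) \<and>
           (\<forall>(x, t) \<in> P. \<forall>s\<in>{0..t}. - \<beta> (t - s) * c - fx x t s = 0) \<and>
           (\<forall>t\<ge>0. \<forall>s\<in>{0..t}. f 0 t s = 0)))"

end

theory Submission
  imports Defs
begin

text \<open>
  Each \<open>V\<^sub>i\<close> solves a linear second-order equation with killing rate \<open>\<delta>\<^sub>i\<close> on \<open>[0, x\<^sub>2]\<close>, and the
  factor \<open>exp (- \<delta>\<^sub>i * (t - s))\<close> turns the killing term into a time derivative.  So the equations for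
  \<open>f\<close> hold component by component (\<open>disc_ode\<close>).  In the equation for the blend \<open>V\<close> the term
  \<open>f\<^sub>s(x, t, t)\<close> is the cost \<open>K = \<omega>\<^sub>1 * \<delta>\<^sub>1 * V\<^sub>1 + \<omega>\<^sub>2 * \<delta>\<^sub>2 * V\<^sub>2\<close>.  The two conditions on \<open>x\<^sub>1\<close>
  and \<open>x\<^sub>2\<close> say \<open>V'(x\<^sub>1) = -1\<close> and \<open>V''(x\<^sub>2-) = 0\<close>.  The second makes \<open>V''\<close> continuous at \<open>x\<^sub>2\<close>,
  and the first makes it continuous at \<open>x\<^sub>1\<close>, because the drift and the running gain jump there by
  amounts that cancel (\<open>curvature_match_x1\<close>).

  The other claims about \<open>V\<close> compare \<open>V'\<close> with \<open>-1\<close> and \<open>-c\<close>, and they follow from \<open>V'' > 0\<close> on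
  \<open>[0, x\<^sub>2)\<close>: then \<open>V'\<close> increases strictly through \<open>-1\<close> at \<open>x\<^sub>1\<close> to \<open>-c\<close> at \<open>x\<^sub>2\<close>.  The strict
  inequality to the left of \<open>x\<^sub>2\<close> matters, because the set where \<open>V' = -c\<close> must not contain points
  at which the individual \<open>V\<^sub>i'\<close> differ from \<open>-c\<close>.  To the right of \<open>x\<^sub>2\<close>, where \<open>V' = -c\<close>, the
  inequality in the system says \<open>K \<le> - \<mu> * c\<close>; equality holds at \<open>x\<^sub>2\<close> and \<open>K\<close> decreases from there.

  To prove \<open>V'' > 0\<close>, differentiate the blended equation:
  \<open>\<sigma>\<^sup>2 / 2 * V''' + b * V'' = K'\<close>, where \<open>b\<close> is the drift.  Wherever \<open>K' < 0\<close>, positivity of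
  \<open>V''\<close> propagates from right to left.  On \<open>[x\<^sub>1, x\<^sub>2]\<close> both \<open>V\<^sub>i'\<close> are negative (\<open>mid'_neg\<close>), so
  \<open>K' < 0\<close> and \<open>V''(x\<^sub>2) = 0\<close> start the propagation (\<open>curvature_pos_mid\<close>).  On \<open>[0, x\<^sub>1]\<close> a single
  component may be increasing near the origin, and \<open>K\<close> with it.  There \<open>curvature_pos_left\<close>
  distinguishes the signs of the coefficients \<open>A\<^sub>i\<^sub>2\<close>, using that a sum of exponentials in which only
  the fastest decaying one has a positive coefficient changes sign at most once, and, when \<open>K\<close> may
  increase at first, that \<open>K \<ge> - \<mu> * c\<close> determines the sign of \<open>V''(0)\<close>.
\<close>

section \<open>Sums of two exponentials and gluing\<close>

definition exp_pair :: "real \<Rightarrow> real \<Rightarrow> real \<Rightarrow> real \<Rightarrow> real \<Rightarrow> real" where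
  "exp_pair p q a b x = a * exp (p * x) + b * exp (- q * x)"

lemma exp_pair_deriv:
  "(exp_pair p q a b has_real_derivative exp_pair p q (p * a) (- q * b) x) (at x within S)"
  unfolding exp_pair_def
  by (auto intro!: derivative_eq_intros simp: field_simps)

lemma continuous_on_exp_pair [continuous_intros]: "continuous_on S (exp_pair p q a b)"
  unfolding exp_pair_def by (intro continuous_intros)

lemma exp_pair_ode:
  assumes "1/2 * \<sigma>\<^sup>2 * p\<^sup>2 + b * p = d" and "1/2 * \<sigma>\<^sup>2 * q\<^sup>2 - b * q = d"
  shows "1/2 * \<sigma>\<^sup>2 * exp_pair p q (p * (p * u)) (- q * (- q * w)) x
       + b * exp_pair p q (p * u) (- q * w) x = d * exp_pair p q u w x"
proof -
  have "1/2 * \<sigma>\<^sup>2 * exp_pair p q (p * (p * u)) (- q * (- q * w)) x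
       + b * exp_pair p q (p * u) (- q * w) x
     = (1/2 * \<sigma>\<^sup>2 * p\<^sup>2 + b * p) * (u * exp (p * x))
       + (1/2 * \<sigma>\<^sup>2 * q\<^sup>2 - b * q) * (w * exp (- q * x))"
    unfolding exp_pair_def by (simp add: power2_eq_square algebra_simps)
  then show ?thesis
    unfolding assms by (simp add: exp_pair_def algebra_simps)
qed

lemma exp_pair_weighted:
  "exp_pair p q a b x * exp (r * x) = a * exp ((r + p) * x) + b * exp ((r - q) * x)"
  by (simp add: exp_pair_def algebra_simps flip: exp_add)

text \<open>Multiplied by \<^term>\<open>exp (q * x)\<close> the pair becomes a constant plus a multiple of an
  increasing function, hence is monotone; so a sign at both ends is a sign in between.\<close>
lemma exp_pair_neg_between:
  assumes "p + q > 0" "l \<le> x" "x \<le> r"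
    and "exp_pair p q a b l < 0" "exp_pair p q a b r < 0"
  shows "exp_pair p q a b x < 0"
proof -
  have w: "exp_pair p q a b y * exp (q * y) = a * exp ((p + q) * y) + b" for y
    unfolding exp_pair_weighted by (simp add: add.commute)
  have neg: "a * exp ((p + q) * y) + b < 0 \<longleftrightarrow> exp_pair p q a b y < 0" for y
    unfolding w [symmetric] by (simp add: mult_less_0_iff)
  have lx: "exp ((p + q) * l) \<le> exp ((p + q) * x)" and xr: "exp ((p + q) * x) \<le> exp ((p + q) * r)"
    using assms by auto
  have "a * exp ((p + q) * x) + b < 0"
  proof (cases "a \<ge> 0")
    case True
    then have "a * exp ((p + q) * x) \<le> a * exp ((p + q) * r)"
      using xr by (rule mult_left_mono [rotated])
    then show ?thesis using neg [of r] assms by linarith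
  next
    case False
    then have "a * exp ((p + q) * x) \<le> a * exp ((p + q) * l)"
      using lx by (intro mult_left_mono_neg) auto
    then show ?thesis using neg [of l] assms by linarith
  qed
  then show ?thesis using neg by blast
qed

lemma has_real_derivative_cong_on:
  assumes "(F has_real_derivative D) (at x within S)" "x \<in> S" "\<And>y. y \<in> S \<Longrightarrow> f y = F y"
  shows "(f has_real_derivative D) (at x within S)"
  using has_field_derivative_transform_within [OF assms(1) zero_less_one assms(2)] assms(3) by simp

lemma has_real_derivative_glue:
  fixes a :: real
  assumes f: "\<And>x. (f has_real_derivative f' x) (at x)"
    and g: "\<And>x. (g has_real_derivative g' x) (at x)"
    and "f a = g a" "f' a = g' a"
  shows "((\<lambda>x. if x < a then f x else g x) has_real_derivative
          (if x < a then f' x else g' x)) (at x)"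
proof -
  let ?h = "\<lambda>x. if x < a then f x else g x"
  consider "x < a" | "x > a" | "x = a" by linarith
  then show ?thesis
  proof cases
    case 1
    have "(?h has_real_derivative f' x) (at x)"
      by (rule has_field_derivative_transform_within_open [OF f, of "{..<a}"]) (use 1 in auto)
    then show ?thesis using 1 by simp
  next
    case 2
    have "(?h has_real_derivative g' x) (at x)"
      by (rule has_field_derivative_transform_within_open [OF g, of "{a<..}"]) (use 2 in auto)
    then show ?thesis using 2 by simp
  next
    case 3
    have l: "(?h has_real_derivative g' a) (at a within {..a})"
      using has_field_derivative_at_within [OF f [of a]]
      by (rule has_field_derivative_transform_within [OF _ zero_less_one, THEN DERIV_cong])
        (use assms in auto)
    have r: "(?h has_real_derivative g' a) (at a within {a..})"
      using has_field_derivative_at_within [OF g [of a]]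
      by (rule has_field_derivative_transform_within [OF _ zero_less_one]) auto
    have "(?h has_real_derivative g' a) (at a within {..a} \<union> {a..})"
      using l r unfolding has_field_derivative_iff by (rule Lim_Un)
    moreover have "{..a} \<union> {a..} = UNIV" by auto
    ultimately show ?thesis using 3 by simp
  qed
qed

lemma continuous_on_glue:
  fixes a :: real
  assumes "continuous_on UNIV f" "continuous_on UNIV g" "f a = g a"
  shows "continuous_on S (\<lambda>x. if x < a then f x else g x)"
proof -
  have "continuous_on S (\<lambda>x. if x \<le> a then f x else g x)"
    by (rule continuous_on_cases_le)
      (use assms in \<open>auto intro: continuous_on_subset continuous_on_id\<close>)
  moreover have "(\<lambda>x. if x \<le> a then f x else g x) = (\<lambda>x. if x < a then f x else g x)"
    using assms(3) by (auto simp: fun_eq_iff)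
  ultimately show ?thesis by (rule back_subst)
qed

lemma exp_weighted_pos: "0 < a * exp y \<Longrightarrow> a * exp y \<le> b * exp z \<Longrightarrow> 0 < b" for a b y z :: real
  by (drule (1) less_le_trans) (simp add: zero_less_mult_iff)

text \<open>With the integrating factor \<^term>\<open>exp (b / k * x)\<close> a one-sided bound on
  \<^term>\<open>k * h' x + b * h x\<close> becomes monotonicity; a nonnegative value of \<^term>\<open>h\<close> at the right
  end then propagates to the left.\<close>
lemma weighted_mono:
  fixes k b :: real
  assumes "k > 0" "l \<le> r"
    and h: "\<And>x. (h has_real_derivative h' x) (at x)"
    and le: "\<And>x. l \<le> x \<Longrightarrow> x \<le> r \<Longrightarrow> k * h' x + b * h x \<le> 0"
  shows "h r * exp (b / k * r) \<le> h l * exp (b / k * l)"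
proof (rule DERIV_nonpos_imp_nonincreasing [OF assms(2)])
  fix x assume x: "l \<le> x" "x \<le> r"
  have "((\<lambda>x. h x * exp (b / k * x)) has_real_derivative
          (k * h' x + b * h x) * (exp (b / k * x) / k)) (at x)"
    by (rule derivative_eq_intros h refl)+ (use assms(1) in \<open>simp add: field_simps\<close>)
  moreover have "(k * h' x + b * h x) * (exp (b / k * x) / k) \<le> 0"
    using le [OF x] assms(1) by (intro mult_nonpos_nonneg) auto
  ultimately show "\<exists>y. ((\<lambda>x. h x * exp (b / k * x)) has_real_derivative y) (at x) \<and> y \<le> 0"
    by blast
qed

lemma weighted_strict_mono:
  fixes k b :: real
  assumes "k > 0" "l < r"
    and h: "\<And>x. (h has_real_derivative h' x) (at x)"
    and less: "\<And>x. l < x \<Longrightarrow> x < r \<Longrightarrow> k * h' x + b * h x < 0"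
  shows "h r * exp (b / k * r) < h l * exp (b / k * l)"
proof (rule DERIV_neg_imp_decreasing_open [OF assms(2)])
  have d: "((\<lambda>x. h x * exp (b / k * x)) has_real_derivative
          (k * h' x + b * h x) * (exp (b / k * x) / k)) (at x)" for x
    by (rule derivative_eq_intros h refl)+ (use assms(1) in \<open>simp add: field_simps\<close>)
  then show "continuous_on {l..r} (\<lambda>x. h x * exp (b / k * x))"
    by (meson DERIV_atLeastAtMost_imp_continuous_on)
  fix x assume x: "l < x" "x < r"
  have "(k * h' x + b * h x) * (exp (b / k * x) / k) < 0"
    using less [OF x] assms(1) by (intro mult_neg_pos) auto
  with d show "\<exists>y. ((\<lambda>x. h x * exp (b / k * x)) has_real_derivative y) (at x) \<and> y < 0"
    by blast
qed

section \<open>The characteristic exponents\<close>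

text \<open>The positive root of \<open>\<sigma>\<^sup>2 / 2 * r\<^sup>2 + b * r = d\<close>.  All four exponents are instances; the
  decaying ones arise from the reversed drift.\<close>
definition char_root :: "real \<Rightarrow> real \<Rightarrow> real \<Rightarrow> real" where
  "char_root b \<sigma> d = (- b + sqrt (b\<^sup>2 + 2 * d * \<sigma>\<^sup>2)) / \<sigma>\<^sup>2"

lemma char_root_pos:
  assumes "\<sigma> > 0" "d > 0"
  shows "char_root b \<sigma> d > 0"
proof -
  have "\<bar>b\<bar> < sqrt (b\<^sup>2 + 2 * d * \<sigma>\<^sup>2)"
    using assms by (intro real_less_rsqrt) auto
  then show ?thesis using assms by (auto simp: char_root_def)
qed

lemma char_root_eq:
  assumes "\<sigma> > 0" "d > 0"
  shows "1/2 * \<sigma>\<^sup>2 * (char_root b \<sigma> d)\<^sup>2 + b * char_root b \<sigma> d = d"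
proof -
  define r where "r = sqrt (b\<^sup>2 + 2 * d * \<sigma>\<^sup>2)"
  have r: "r\<^sup>2 = b\<^sup>2 + 2 * d * \<sigma>\<^sup>2"
    using assms by (simp add: r_def)
  have "1/2 * \<sigma>\<^sup>2 * (char_root b \<sigma> d)\<^sup>2 + b * char_root b \<sigma> d = (r\<^sup>2 - b\<^sup>2) / (2 * \<sigma>\<^sup>2)"
    using assms unfolding char_root_def r_def [symmetric]
    by (simp add: field_simps power2_eq_square)
  then show ?thesis using assms r by simp
qed

lemma char_root_mono:
  assumes "\<sigma> > 0" "d \<le> e"
  shows "char_root b \<sigma> d \<le> char_root b \<sigma> e"
  using assms unfolding char_root_def
  by (intro divide_right_mono add_left_mono real_sqrt_le_mono) auto

lemma theta_char_root:
  "theta \<mu> \<sigma> M d 1 = char_root (\<mu> + M) \<sigma> d" "theta \<mu> \<sigma> M d 2 = char_root (- (\<mu> + M)) \<sigma> d"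
  "theta \<mu> \<sigma> M d 3 = char_root \<mu> \<sigma> d" "theta \<mu> \<sigma> M d 4 = char_root (- \<mu>) \<sigma> d"
proof -
  have "(- \<mu> - M)\<^sup>2 = (\<mu> + M)\<^sup>2" by algebra
  then show "theta \<mu> \<sigma> M d 2 = char_root (- (\<mu> + M)) \<sigma> d"
    by (simp add: theta_def char_root_def)
qed (auto simp: theta_def char_root_def)

section \<open>A single discount rate\<close>

text \<open>The free boundaries are arbitrary here; only the blend of two rates ties them together.\<close>

locale component =
  fixes \<mu> \<sigma> M c d x1 x2 :: real
  assumes \<mu>_pos: "\<mu> > 0" and \<sigma>_pos: "\<sigma> > 0" and M_pos: "M > 0" and c_pos: "c > 0"
    and d_pos: "d > 0" and x1_pos: "0 < x1" and x1_less_x2: "x1 < x2"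
begin

abbreviation \<theta> :: "nat \<Rightarrow> real" where "\<theta> \<equiv> theta \<mu> \<sigma> M d"
abbreviation A :: "nat \<Rightarrow> real" where "A \<equiv> A_coeff \<mu> \<sigma> M c d x1 x2"
abbreviation v :: "real \<Rightarrow> real" where "v \<equiv> V_comp \<mu> \<sigma> M c d x1 x2"

lemma \<theta>_pos: "\<theta> 1 > 0" "\<theta> 2 > 0" "\<theta> 3 > 0" "\<theta> 4 > 0"
  using char_root_pos \<sigma>_pos d_pos by (auto simp only: theta_char_root)

lemma \<theta>_eq:
  "1/2 * \<sigma>\<^sup>2 * (\<theta> 1)\<^sup>2 + (\<mu> + M) * \<theta> 1 = d" "1/2 * \<sigma>\<^sup>2 * (\<theta> 2)\<^sup>2 - (\<mu> + M) * \<theta> 2 = d"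
  "1/2 * \<sigma>\<^sup>2 * (\<theta> 3)\<^sup>2 + \<mu> * \<theta> 3 = d" "1/2 * \<sigma>\<^sup>2 * (\<theta> 4)\<^sup>2 - \<mu> * \<theta> 4 = d"
  using char_root_eq [OF \<sigma>_pos d_pos, of "\<mu> + M"] char_root_eq [OF \<sigma>_pos d_pos, of "- (\<mu> + M)"]
    char_root_eq [OF \<sigma>_pos d_pos, of \<mu>] char_root_eq [OF \<sigma>_pos d_pos, of "- \<mu>"]
  unfolding theta_char_root by (simp_all only: mult_minus_left diff_conv_add_uminus)

text \<open>Eliminating the other unknowns leaves one linear equation for \<open>A 1\<close>.  Its slope \<open>p\<close> is positive: raising \<open>A 1\<close> raises value and derivative
  of the left piece at \<^term>\<open>x1\<close>, hence the derivative of the middle piece at \<^term>\<open>x2\<close>.\<close>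
lemma coeff_system_ex1:
  "\<exists>!B. coeff_system \<mu> \<sigma> M c d x1 x2 B \<and> (\<forall>j. j \<notin> {1..5} \<longrightarrow> B j = 0)"
proof -
  define E1 E2 F3 F4 G3 G4 where "E1 = exp (\<theta> 1 * x1)" and "E2 = exp (- \<theta> 2 * x1)"
    and "F3 = exp (\<theta> 3 * x1)" and "F4 = exp (- \<theta> 4 * x1)"
    and "G3 = exp (\<theta> 3 * x2)" and "G4 = exp (- \<theta> 4 * x2)"
  note E_defs = this
  define s where "s = \<theta> 3 + \<theta> 4"
  have s: "s > 0" using \<theta>_pos by (simp add: s_def)
  have pos: "F3 > 0" "F4 > 0" "G3 > 0" "G4 > 0" "E1 > 0" "E2 > 0" by (auto simp: E_defs)
  have "F3 < G3" "G4 < F4" using \<theta>_pos x1_less_x2 by (auto simp: E_defs)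
  then have ratio: "G4 / F4 < G3 / F3" using pos
    by (smt (verit) divide_less_eq_1_pos less_divide_eq_1_pos)
  have "E1 > 1" "E2 < 1" using \<theta>_pos x1_pos by (auto simp: E_defs)
  then have v1: "E1 - E2 > 0" by simp
  have k1: "\<theta> 1 * E1 + \<theta> 2 * E2 > 0" using pos \<theta>_pos by (simp add: add_pos_pos)
  \<comment> \<open>Value and slope of the left piece at \<^term>\<open>x1\<close>, then the middle coefficients matching them.\<close>
  define val slo where "val a = M / d * (1 - E2) + a * (E1 - E2)"
    and "slo a = M / d * \<theta> 2 * E2 + a * (\<theta> 1 * E1 + \<theta> 2 * E2)" for a
  define P Q where "P a = (\<theta> 4 * val a + slo a) / (s * F3)"
    and "Q a = (\<theta> 3 * val a - slo a) / (s * F4)" for a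
  define p q where
    "p = \<theta> 3 * (\<theta> 4 * (E1 - E2) + (\<theta> 1 * E1 + \<theta> 2 * E2)) / s * (G3 / F3)
       - \<theta> 4 * (\<theta> 3 * (E1 - E2) - (\<theta> 1 * E1 + \<theta> 2 * E2)) / s * (G4 / F4)"
    and "q = \<theta> 3 * P 0 * G3 - \<theta> 4 * Q 0 * G4"
  have lin: "\<theta> 3 * P a * G3 - \<theta> 4 * Q a * G4 = p * a + q" for a
    unfolding p_def q_def P_def Q_def val_def slo_def using s pos
    by (simp add: field_simps)
  have "p = \<theta> 3 * \<theta> 4 * (E1 - E2) / s * (G3 / F3 - G4 / F4)
          + (\<theta> 1 * E1 + \<theta> 2 * E2) / s * (\<theta> 3 * (G3 / F3) + \<theta> 4 * (G4 / F4))"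
    unfolding p_def using s pos by (simp add: field_simps)
  also have "\<dots> > 0"
    using s pos ratio v1 k1 \<theta>_pos by (intro add_pos_pos mult_pos_pos divide_pos_pos) auto
  finally have p: "p > 0" .
  have sys: "coeff_system \<mu> \<sigma> M c d x1 x2 B \<longleftrightarrow>
      B 2 = - M / d - B 1 \<and> B 3 = P (B 1) \<and> B 4 = Q (B 1) \<and> p * B 1 + q = - c
      \<and> B 5 = c * x2 + B 3 * G3 + B 4 * G4" for B
  proof -
    have match: "(v = B 3 * F3 + B 4 * F4 \<and> k = B 3 * \<theta> 3 * F3 - B 4 * \<theta> 4 * F4)
       \<longleftrightarrow> (B 3 = (\<theta> 4 * v + k) / (s * F3) \<and> B 4 = (\<theta> 3 * v - k) / (s * F4))" for v k
    proof
      assume a: "v = B 3 * F3 + B 4 * F4 \<and> k = B 3 * \<theta> 3 * F3 - B 4 * \<theta> 4 * F4"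
      have "\<theta> 4 * v + k = B 3 * (s * F3)" "\<theta> 3 * v - k = B 4 * (s * F4)"
        unfolding conjunct1 [OF a] conjunct2 [OF a] s_def by (simp_all add: algebra_simps)
      then show "B 3 = (\<theta> 4 * v + k) / (s * F3) \<and> B 4 = (\<theta> 3 * v - k) / (s * F4)"
        using s pos by simp
    next
      assume a: "B 3 = (\<theta> 4 * v + k) / (s * F3) \<and> B 4 = (\<theta> 3 * v - k) / (s * F4)"
      then have b: "B 3 * F3 = (\<theta> 4 * v + k) / s" "B 4 * F4 = (\<theta> 3 * v - k) / s"
        using s pos by simp_all
      have "B 3 * F3 + B 4 * F4 = v * (\<theta> 3 + \<theta> 4) / s" unfolding b
        by (simp add: algebra_simps flip: add_divide_distrib)
      moreover have "\<theta> 3 * (B 3 * F3) - \<theta> 4 * (B 4 * F4) = k * (\<theta> 3 + \<theta> 4) / s" unfolding b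
        by (simp add: algebra_simps flip: add_divide_distrib diff_divide_distrib)
      ultimately show "v = B 3 * F3 + B 4 * F4 \<and> k = B 3 * \<theta> 3 * F3 - B 4 * \<theta> 4 * F4"
        using s by (simp add: s_def [symmetric] mult_ac)
    qed
    have 1: "M / d + B 1 + B 2 = 0 \<longleftrightarrow> B 2 = - M / d - B 1" by auto
    have left: "M / d + B 1 * E1 + B 2 * E2 = val (B 1)"
      "B 1 * \<theta> 1 * E1 - B 2 * \<theta> 2 * E2 = slo (B 1)"
      if "B 2 = - M / d - B 1" unfolding that val_def slo_def by (simp_all add: algebra_simps diff_divide_distrib)
    have last: "B 3 * \<theta> 3 * G3 - B 4 * \<theta> 4 * G4 = p * B 1 + q"
      if "B 3 = P (B 1)" "B 4 = Q (B 1)" unfolding that lin [symmetric] by simp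
    show ?thesis
      unfolding coeff_system_def Let_def E_defs [symmetric] 1
      using left last match [of "val (B 1)" "slo (B 1)"] unfolding P_def [symmetric] Q_def [symmetric]
      by (auto simp: algebra_simps)
  qed
  define a where "a = (- c - q) / p"
  have a: "p * y + q = - c \<longleftrightarrow> y = a" for y
    using p by (auto simp: a_def field_simps)
  define B where "B j = (if j = 1 then a else if j = 2 then - M / d - a else if j = 3 then P a
     else if j = 4 then Q a else if j = 5 then c * x2 + P a * G3 + Q a * G4 else 0)" for j :: nat
  show ?thesis
  proof (rule ex1I [of _ B])
    show "coeff_system \<mu> \<sigma> M c d x1 x2 B \<and> (\<forall>j. j \<notin> {1..5} \<longrightarrow> B j = 0)"
      unfolding sys a by (auto simp: B_def)
    fix C assume C: "coeff_system \<mu> \<sigma> M c d x1 x2 C \<and> (\<forall>j. j \<notin> {1..5} \<longrightarrow> C j = 0)"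
    show "C = B"
    proof
      fix j :: nat
      consider "j = 1" | "j = 2" | "j = 3" | "j = 4" | "j = 5" | "j < 1 \<or> j > 5"
        by linarith
      then show "C j = B j"
        using C unfolding sys a by cases (auto simp: B_def)
    qed
  qed
qed

lemma coeff_system_A: "coeff_system \<mu> \<sigma> M c d x1 x2 A"
  using theI' [OF coeff_system_ex1] unfolding A_coeff_def by blast

text \<open>The three pieces are kept as functions on the whole line, so that they can be differentiated
  and compared at the free boundaries.\<close>
definition left :: "real \<Rightarrow> real" where
  "left x = M / d + exp_pair (\<theta> 1) (\<theta> 2) (A 1) (A 2) x"
definition left' :: "real \<Rightarrow> real" where
  "left' = exp_pair (\<theta> 1) (\<theta> 2) (\<theta> 1 * A 1) (- \<theta> 2 * A 2)"
definition left'' :: "real \<Rightarrow> real" where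
  "left'' = exp_pair (\<theta> 1) (\<theta> 2) (\<theta> 1 * (\<theta> 1 * A 1)) (- \<theta> 2 * (- \<theta> 2 * A 2))"
definition left''' :: "real \<Rightarrow> real" where
  "left''' = exp_pair (\<theta> 1) (\<theta> 2) (\<theta> 1 * (\<theta> 1 * (\<theta> 1 * A 1))) (- \<theta> 2 * (- \<theta> 2 * (- \<theta> 2 * A 2)))"
definition mid :: "real \<Rightarrow> real" where
  "mid = exp_pair (\<theta> 3) (\<theta> 4) (A 3) (A 4)"
definition mid' :: "real \<Rightarrow> real" where
  "mid' = exp_pair (\<theta> 3) (\<theta> 4) (\<theta> 3 * A 3) (- \<theta> 4 * A 4)"
definition mid'' :: "real \<Rightarrow> real" where
  "mid'' = exp_pair (\<theta> 3) (\<theta> 4) (\<theta> 3 * (\<theta> 3 * A 3)) (- \<theta> 4 * (- \<theta> 4 * A 4))"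
definition mid''' :: "real \<Rightarrow> real" where
  "mid''' = exp_pair (\<theta> 3) (\<theta> 4) (\<theta> 3 * (\<theta> 3 * (\<theta> 3 * A 3))) (- \<theta> 4 * (- \<theta> 4 * (- \<theta> 4 * A 4)))"
definition right :: "real \<Rightarrow> real" where
  "right x = - c * x + A 5"

definition slope :: "real \<Rightarrow> real" where
  "slope x = (if x < x1 then left' x else if x < x2 then mid' x else - c)"

text \<open>At the free boundaries the value from inside the closed middle piece is taken.\<close>
definition curvature :: "real \<Rightarrow> real" where
  "curvature x = (if x < x1 then left'' x else if x \<le> x2 then mid'' x else 0)"

lemma piece_derivs:
  "(left has_real_derivative left' x) (at x)"
  "(left' has_real_derivative left'' x) (at x)"
  "(left'' has_real_derivative left''' x) (at x)"
  "(mid has_real_derivative mid' x) (at x)"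
  "(mid' has_real_derivative mid'' x) (at x)"
  "(mid'' has_real_derivative mid''' x) (at x)"
  "(right has_real_derivative - c) (at x)"
proof -
  show "(left has_real_derivative left' x) (at x)"
    unfolding left_def left'_def by (rule derivative_eq_intros exp_pair_deriv refl | simp)+
  show "(right has_real_derivative - c) (at x)"
    unfolding right_def by (auto intro!: derivative_eq_intros)
qed (simp_all only: left'_def left''_def left'''_def mid_def mid'_def mid''_def mid'''_def
       exp_pair_deriv)

lemma continuous_pieces:
  "continuous_on S left''" "continuous_on S mid''"
  by (auto simp: left''_def mid''_def intro: continuous_intros)

lemma boundary_conditions:
  "left 0 = 0" "left x1 = mid x1" "left' x1 = mid' x1" "mid x2 = right x2" "mid' x2 = - c"
  using coeff_system_A
  by (auto simp: coeff_system_def Let_def left_def left'_def mid_def mid'_def right_def exp_pair_def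
      algebra_simps)

lemma piece_ode:
  "(\<mu> + M) * left' x + 1/2 * \<sigma>\<^sup>2 * left'' x + M = d * left x"
  "(\<mu> + M) * left'' x + 1/2 * \<sigma>\<^sup>2 * left''' x = d * left' x"
  "\<mu> * mid' x + 1/2 * \<sigma>\<^sup>2 * mid'' x = d * mid x"
  "\<mu> * mid'' x + 1/2 * \<sigma>\<^sup>2 * mid''' x = d * mid' x"
proof -
  note o = exp_pair_ode [OF \<theta>_eq(1,2)]
  have "d * (M / d) = M" using d_pos by simp
  then show "(\<mu> + M) * left' x + 1/2 * \<sigma>\<^sup>2 * left'' x + M = d * left x"
    using o [of "A 1" "A 2" x] unfolding left_def left'_def left''_def distrib_left by linarith
  show "(\<mu> + M) * left'' x + 1/2 * \<sigma>\<^sup>2 * left''' x = d * left' x"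
    using o [of "\<theta> 1 * A 1" "- \<theta> 2 * A 2" x] unfolding left'_def left''_def left'''_def by linarith
  note o = exp_pair_ode [OF \<theta>_eq(3,4)]
  show "\<mu> * mid' x + 1/2 * \<sigma>\<^sup>2 * mid'' x = d * mid x"
    using o [of "A 3" "A 4" x] unfolding mid_def mid'_def mid''_def by linarith
  show "\<mu> * mid'' x + 1/2 * \<sigma>\<^sup>2 * mid''' x = d * mid' x"
    using o [of "\<theta> 3 * A 3" "- \<theta> 4 * A 4" x] unfolding mid'_def mid''_def mid'''_def by linarith
qed

lemma V_comp_pieces:
  "v x = (if x < x1 then left x else if x < x2 then mid x else right x)"
  unfolding V_comp_def Let_def left_def mid_def right_def exp_pair_def by simp

lemma V_comp_0: "v 0 = 0"
  using boundary_conditions x1_pos by (simp add: V_comp_pieces)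

lemma V_comp_deriv: "(v has_real_derivative slope x) (at x)"
proof -
  have tail: "((\<lambda>x. if x < x2 then mid x else right x) has_real_derivative
          (if x < x2 then mid' x else - c)) (at x)" for x
    by (rule has_real_derivative_glue) (auto intro: piece_derivs simp: boundary_conditions)
  show ?thesis
    unfolding V_comp_pieces slope_def
    by (rule has_real_derivative_glue [OF piece_derivs(1) tail])
      (use boundary_conditions x1_less_x2 in auto)
qed

lemma continuous_v: "continuous_on S v"
  by (meson V_comp_deriv DERIV_isCont continuous_at_imp_continuous_on)

lemma continuous_slope: "continuous_on S slope"
  unfolding slope_def
  by (intro continuous_on_glue)
    (use boundary_conditions x1_less_x2 in
      \<open>auto intro: continuous_on_const continuous_on_exp_pair simp: left'_def mid'_def\<close>)

lemma slope_deriv: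
  assumes "x \<noteq> x1" "x \<noteq> x2"
  shows "(slope has_real_derivative curvature x) (at x)"
proof -
  consider "x < x1" | "x1 < x" "x < x2" | "x > x2" using assms by linarith
  then show ?thesis
  proof cases
    case 1
    have "(slope has_real_derivative left'' x) (at x)"
      by (rule has_field_derivative_transform_within_open [OF piece_derivs(2), of "{..<x1}"])
        (use 1 in \<open>auto simp: slope_def\<close>)
    then show ?thesis using 1 by (simp add: curvature_def)
  next
    case 2
    have "(slope has_real_derivative mid'' x) (at x)"
      by (rule has_field_derivative_transform_within_open [OF piece_derivs(5), of "{x1<..<x2}"])
        (use 2 in \<open>auto simp: slope_def\<close>)
    then show ?thesis using 2 by (simp add: curvature_def)
  next
    case 3
    have "(slope has_real_derivative 0) (at x)"
      by (rule has_field_derivative_transform_within_open [OF DERIV_const [of "- c"], of "{x2<..}"])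
        (use 3 x1_less_x2 in \<open>auto simp: slope_def\<close>)
    then show ?thesis using 3 x1_less_x2 by (simp add: curvature_def)
  qed
qed

lemma component_ode:
  assumes "x \<le> x2"
  shows "(\<mu> + Pi_hat M x1 x t) * slope x + 1/2 * \<sigma>\<^sup>2 * curvature x + Pi_hat M x1 x t
     = d * v x"
proof -
  consider "x < x1" | "x1 \<le> x" "x < x2" | "x = x2" using assms by linarith
  then show ?thesis
  proof cases
    case 1
    then have "v x = left x" "slope x = left' x" "curvature x = left'' x"
      "Pi_hat M x1 x t = M"
      by (simp_all add: V_comp_pieces slope_def curvature_def Pi_hat_def)
    then show ?thesis using piece_ode(1) [of x] by (simp only:)
  next
    case 2
    then have "v x = mid x" "slope x = mid' x" "curvature x = mid'' x"
      "Pi_hat M x1 x t = 0"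
      by (simp_all add: V_comp_pieces slope_def curvature_def Pi_hat_def)
    then show ?thesis using piece_ode(3) [of x] by simp
  next
    case 3
    then have "v x = mid x" "slope x = mid' x" "curvature x = mid'' x"
      "Pi_hat M x1 x t = 0"
      using x1_less_x2 boundary_conditions(4,5)
      by (simp_all add: V_comp_pieces slope_def curvature_def Pi_hat_def)
    then show ?thesis using piece_ode(3) [of x] by simp
  qed
qed

text \<open>A nonnegative slope at \<^term>\<open>x1\<close> is impossible: seen from the left, where the dividend
  rate \<^term>\<open>M\<close> is earned and the value starts from zero, it would force a positive value at
  \<^term>\<open>x1\<close>; seen from the right, where nothing is earned and the slope ends at \<^term>\<open>-c\<close>,
  a negative one.\<close>
lemma mid'_x1_neg: "mid' x1 < 0"
proof (rule ccontr)
  assume "\<not> mid' x1 < 0"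
  then have k: "left' x1 \<ge> 0" and k': "mid' x1 \<ge> 0" using boundary_conditions by auto
  define E1 E2 where "E1 = exp (\<theta> 1 * x1)" and "E2 = exp (- \<theta> 2 * x1)"
  have E: "E1 > 1" "E2 < 1" "E2 > 0" using \<theta>_pos x1_pos by (auto simp: E1_def E2_def)
  have inv: "exp (\<theta> 2 * x1) * E2 = 1" "exp (- \<theta> 1 * x1) * E1 = 1"
    by (simp_all add: E1_def E2_def flip: exp_add)
  define m where "m = M / d"
  have A2: "A 2 = - m - A 1"
    unfolding m_def using coeff_system_A by (auto simp: coeff_system_def Let_def)
  have m: "m > 0" using M_pos d_pos by (simp add: m_def)
  have D: "\<theta> 1 * E1 + \<theta> 2 * E2 > 0" using E \<theta>_pos by (simp add: add_pos_pos)
  have slope: "A 1 * (\<theta> 1 * E1 + \<theta> 2 * E2) \<ge> - m * \<theta> 2 * E2"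
    using k unfolding left'_def exp_pair_def A2 E1_def [symmetric] E2_def [symmetric]
    by (simp add: algebra_simps)
  have val: "left x1 = m * (1 - E2) + A 1 * (E1 - E2)"
    unfolding left_def exp_pair_def A2 m_def [symmetric] E1_def [symmetric] E2_def [symmetric]
    by (simp add: algebra_simps)
  \<comment> \<open>Divided by \<open>E1 * E2\<close>, positivity of the value follows from
    \<open>exp y \<ge> 1 + y\<close>, which is strict for \<open>y = \<theta> 2 * x1\<close>.\<close>
  have e1: "exp (\<theta> 2 * x1) > 1 + \<theta> 2 * x1"
  proof -
    have y: "\<theta> 2 * x1 > 0" using \<theta>_pos(2) x1_pos by (rule mult_pos_pos)
    then have "(\<theta> 2 * x1)\<^sup>2 > 0" by (rule zero_less_power)
    then show ?thesis using exp_lower_Taylor_quadratic [OF less_imp_le [OF y]] by linarith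
  qed
  have e2: "exp (- \<theta> 1 * x1) \<ge> 1 - \<theta> 1 * x1"
    using exp_ge_add_one_self [of "- \<theta> 1 * x1"] by simp
  have "\<theta> 1 * (1 + \<theta> 2 * x1) + \<theta> 2 * (1 - \<theta> 1 * x1)
      < \<theta> 1 * exp (\<theta> 2 * x1) + \<theta> 2 * exp (- \<theta> 1 * x1)"
    using e1 e2 \<theta>_pos by (intro add_less_le_mono mult_strict_left_mono mult_left_mono) auto
  then have "\<theta> 1 + \<theta> 2 < \<theta> 1 * exp (\<theta> 2 * x1) + \<theta> 2 * exp (- \<theta> 1 * x1)"
    by (simp add: algebra_simps)
  then have "(\<theta> 1 + \<theta> 2) * (E1 * E2) < (\<theta> 1 * exp (\<theta> 2 * x1) + \<theta> 2 * exp (- \<theta> 1 * x1)) * (E1 * E2)"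
    using E by (intro mult_strict_right_mono) auto
  also have "\<dots> = \<theta> 1 * E1 * (exp (\<theta> 2 * x1) * E2) + \<theta> 2 * E2 * (exp (- \<theta> 1 * x1) * E1)"
    by (simp add: algebra_simps)
  finally have key: "(\<theta> 1 + \<theta> 2) * (E1 * E2) < \<theta> 1 * E1 + \<theta> 2 * E2"
    unfolding inv by simp
  have "0 < m * (\<theta> 1 * E1 + \<theta> 2 * E2 - (\<theta> 1 + \<theta> 2) * (E1 * E2))"
    using m key by (intro mult_pos_pos) auto
  also have "\<dots> = m * (1 - E2) * (\<theta> 1 * E1 + \<theta> 2 * E2) + (- m * \<theta> 2 * E2) * (E1 - E2)"
    by (simp add: algebra_simps)
  also have "\<dots> \<le> m * (1 - E2) * (\<theta> 1 * E1 + \<theta> 2 * E2)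
                + (A 1 * (\<theta> 1 * E1 + \<theta> 2 * E2)) * (E1 - E2)"
    using slope E by (intro add_left_mono mult_right_mono) auto
  also have "\<dots> = left x1 * (\<theta> 1 * E1 + \<theta> 2 * E2)"
    unfolding val by (simp add: algebra_simps)
  finally have pos: "left x1 > 0" using D by (simp add: zero_less_mult_iff)
  define u w where "u = A 3 * exp (\<theta> 3 * x1)" and "w = A 4 * exp (- \<theta> 4 * x1)"
  define l where "l = x2 - x1"
  have l: "l > 0" using x1_less_x2 by (simp add: l_def)
  have "A 3 * exp (\<theta> 3 * x2) = u * exp (\<theta> 3 * l)" "A 4 * exp (- \<theta> 4 * x2) = w * exp (- \<theta> 4 * l)"
    by (simp_all add: u_def w_def l_def algebra_simps flip: exp_add)
  then have end2: "\<theta> 3 * u * exp (\<theta> 3 * l) - \<theta> 4 * w * exp (- \<theta> 4 * l) < 0"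
    using boundary_conditions(5) c_pos unfolding mid'_def exp_pair_def by (simp add: mult.assoc)
  have start: "\<theta> 3 * u \<ge> \<theta> 4 * w"
    using k' by (simp add: mid'_def exp_pair_def u_def w_def)
  \<comment> \<open>A nonnegative growing part would keep the slope nonnegative all the way to \<^term>\<open>x2\<close>.\<close>
  have "u < 0"
  proof (rule ccontr)
    assume "\<not> u < 0"
    then have "\<theta> 3 * u * exp (- \<theta> 4 * l) \<le> \<theta> 3 * u * exp (\<theta> 3 * l)"
      using \<theta>_pos \<open>\<not> u < 0\<close> mult_pos_pos [OF \<theta>_pos(3) l] mult_pos_pos [OF \<theta>_pos(4) l]
      by (intro mult_left_mono) simp_all
    moreover have "\<theta> 4 * w * exp (- \<theta> 4 * l) \<le> \<theta> 3 * u * exp (- \<theta> 4 * l)"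
      using start by (intro mult_right_mono) auto
    ultimately show False using end2 by linarith
  qed
  then have "\<theta> 3 * u < 0" using \<theta>_pos by (simp add: mult_pos_neg)
  then have "\<theta> 4 * w < 0" using start by linarith
  then have "w < 0" using \<theta>_pos by (simp add: mult_less_0_iff)
  with \<open>u < 0\<close> have "mid x1 < 0" by (simp add: mid_def exp_pair_def u_def w_def)
  with pos boundary_conditions show False by simp
qed

text \<open>The slope is negative at both ends of the middle piece.\<close>
lemma mid'_neg:
  assumes "x1 \<le> x" "x \<le> x2"
  shows "mid' x < 0"
  unfolding mid'_def
proof (rule exp_pair_neg_between [OF _ assms])
  show "\<theta> 3 + \<theta> 4 > 0" using \<theta>_pos by linarith
  have "mid' x2 < 0" using boundary_conditions(5) c_pos by linarith
  with mid'_x1_neg show "exp_pair (\<theta> 3) (\<theta> 4) (\<theta> 3 * A 3) (- \<theta> 4 * A 4) x1 < 0"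
    and "exp_pair (\<theta> 3) (\<theta> 4) (\<theta> 3 * A 3) (- \<theta> 4 * A 4) x2 < 0"
    unfolding mid'_def by blast+
qed

text \<open>Since \<open>A 2 = - M / d - A 1\<close>, a nonnegative \<open>A 1\<close> would make both terms of the slope at
  \<^term>\<open>x1\<close> nonnegative.  The sign of \<open>A 2\<close>, in contrast, depends on the parameters.\<close>
lemma A1_neg: "A 1 < 0"
proof (rule ccontr)
  assume a: "\<not> A 1 < 0"
  have "A 2 = - M / d - A 1"
    using coeff_system_A by (auto simp: coeff_system_def Let_def)
  then have "A 2 < 0" using a divide_pos_pos [OF M_pos d_pos] by simp
  then have "- \<theta> 2 * A 2 \<ge> 0" "\<theta> 1 * A 1 \<ge> 0"
    using a \<theta>_pos by (simp_all add: mult_le_0_iff)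
  then have "left' x1 \<ge> 0"
    unfolding left'_def exp_pair_def
    by (intro add_nonneg_nonneg [OF mult_nonneg_nonneg mult_nonneg_nonneg] exp_ge_zero)
  then show False using mid'_x1_neg boundary_conditions by simp
qed

end

section \<open>Blending two discount rates\<close>

locale equilibrium =
  one: component \<mu> \<sigma> M c \<delta>\<^sub>1 x1 x2 + two: component \<mu> \<sigma> M c \<delta>\<^sub>2 x1 x2
  for \<mu> \<sigma> M c \<delta>\<^sub>1 \<delta>\<^sub>2 x1 x2 :: real +
  fixes \<omega>\<^sub>1 \<omega>\<^sub>2 :: real
  assumes c_less_1: "c < 1" and \<delta>_less: "\<delta>\<^sub>1 < \<delta>\<^sub>2"
    and \<omega>_pos: "\<omega>\<^sub>1 > 0" "\<omega>\<^sub>2 > 0" and \<omega>_sum: "\<omega>\<^sub>1 + \<omega>\<^sub>2 = 1"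
    and slope_x1: "\<omega>\<^sub>1 * one.left' x1 + \<omega>\<^sub>2 * two.left' x1 = -1"
    and curvature_x2: "\<omega>\<^sub>1 * one.mid'' x2 + \<omega>\<^sub>2 * two.mid'' x2 = 0"
begin

abbreviation mix :: "(real \<Rightarrow> real) \<Rightarrow> (real \<Rightarrow> real) \<Rightarrow> real \<Rightarrow> real" where
  "mix F G \<equiv> \<lambda>x. \<omega>\<^sub>1 * F x + \<omega>\<^sub>2 * G x"

text \<open>Each component carries its own rate.  With the components of \<open>V\<close> for \<open>F\<close> and
  \<open>G\<close> this is \<open>f\<^sub>s(x, t, t)\<close>, the term by which the blended equation differs from an equation for
  \<open>V\<close> alone.\<close>
abbreviation mix\<delta> :: "(real \<Rightarrow> real) \<Rightarrow> (real \<Rightarrow> real) \<Rightarrow> real \<Rightarrow> real" where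
  "mix\<delta> F G \<equiv> \<lambda>x. \<omega>\<^sub>1 * (\<delta>\<^sub>1 * F x) + \<omega>\<^sub>2 * (\<delta>\<^sub>2 * G x)"

text \<open>The inhomogeneity \<open>a\<close> survives unchanged because the weights sum to one.\<close>
lemma mix_combine:
  assumes "k * F' + b * F + a = d * E" "k * G' + b * G + a = e * D"
  shows "k * (\<omega>\<^sub>1 * F' + \<omega>\<^sub>2 * G') + b * (\<omega>\<^sub>1 * F + \<omega>\<^sub>2 * G) + a
       = \<omega>\<^sub>1 * (d * E) + \<omega>\<^sub>2 * (e * D)"
proof -
  have "\<omega>\<^sub>1 * (d * E) + \<omega>\<^sub>2 * (e * D)
      = k * (\<omega>\<^sub>1 * F' + \<omega>\<^sub>2 * G') + b * (\<omega>\<^sub>1 * F + \<omega>\<^sub>2 * G) + (\<omega>\<^sub>1 + \<omega>\<^sub>2) * a"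
    unfolding assms [symmetric] by (simp add: algebra_simps)
  then show ?thesis by (simp add: \<omega>_sum)
qed

lemma mix_ode:
  "1/2 * \<sigma>\<^sup>2 * mix one.left'' two.left'' x + (\<mu> + M) * mix one.left' two.left' x + M
     = mix\<delta> one.left two.left x"
  "1/2 * \<sigma>\<^sup>2 * mix one.left''' two.left''' x + (\<mu> + M) * mix one.left'' two.left'' x
     = mix\<delta> one.left' two.left' x"
  "1/2 * \<sigma>\<^sup>2 * mix one.mid'' two.mid'' x + \<mu> * mix one.mid' two.mid' x = mix\<delta> one.mid two.mid x"
  "1/2 * \<sigma>\<^sup>2 * mix one.mid''' two.mid''' x + \<mu> * mix one.mid'' two.mid'' x
     = mix\<delta> one.mid' two.mid' x"
proof -
  show "1/2 * \<sigma>\<^sup>2 * mix one.left'' two.left'' x + (\<mu> + M) * mix one.left' two.left' x + M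
     = mix\<delta> one.left two.left x"
    using one.piece_ode(1) two.piece_ode(1) by (intro mix_combine) (simp_all only: add_ac)
  show "1/2 * \<sigma>\<^sup>2 * mix one.left''' two.left''' x + (\<mu> + M) * mix one.left'' two.left'' x
     = mix\<delta> one.left' two.left' x"
    using mix_combine [of _ _ _ _ 0, simplified add_0_right]
      one.piece_ode(2) [unfolded add.commute [of "_ * one.left'' _"]]
      two.piece_ode(2) [unfolded add.commute [of "_ * two.left'' _"]] by blast
  show "1/2 * \<sigma>\<^sup>2 * mix one.mid'' two.mid'' x + \<mu> * mix one.mid' two.mid' x
     = mix\<delta> one.mid two.mid x"
    using mix_combine [of _ _ _ _ 0, simplified add_0_right]
      one.piece_ode(3) [unfolded add.commute [of "_ * one.mid' _"]]
      two.piece_ode(3) [unfolded add.commute [of "_ * two.mid' _"]] by blast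
  show "1/2 * \<sigma>\<^sup>2 * mix one.mid''' two.mid''' x + \<mu> * mix one.mid'' two.mid'' x
     = mix\<delta> one.mid' two.mid' x"
    using mix_combine [of _ _ _ _ 0, simplified add_0_right]
      one.piece_ode(4) [unfolded add.commute [of "_ * one.mid'' _"]]
      two.piece_ode(4) [unfolded add.commute [of "_ * two.mid'' _"]] by blast
qed

lemma mix_deriv:
  assumes "(F has_real_derivative F') (at x within S)" "(G has_real_derivative G') (at x within S)"
  shows "(mix F G has_real_derivative \<omega>\<^sub>1 * F' + \<omega>\<^sub>2 * G') (at x within S)"
    and "(mix\<delta> F G has_real_derivative \<omega>\<^sub>1 * (\<delta>\<^sub>1 * F') + \<omega>\<^sub>2 * (\<delta>\<^sub>2 * G')) (at x within S)"
  by (intro DERIV_add DERIV_cmult assms)+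

lemma mix_neg: "F x < 0 \<Longrightarrow> G x < 0 \<Longrightarrow> mix F G x < 0" "F x < 0 \<Longrightarrow> G x < 0 \<Longrightarrow> mix\<delta> F G x < 0"
  using \<omega>_pos one.d_pos two.d_pos
  by (auto intro!: add_neg_neg mult_pos_neg)

text \<open>Subtracting the two equations at \<^term>\<open>x1\<close> shows that the second derivative of each
  component jumps by a multiple of one plus its slope; the blended slope there is \<^term>\<open>-1\<close>.\<close>
lemma curvature_match_x1: "mix one.left'' two.left'' x1 = mix one.mid'' two.mid'' x1"
proof -
  have eq: "mix\<delta> one.left two.left x1 = mix\<delta> one.mid two.mid x1"
    "mix one.mid' two.mid' x1 = -1" "mix one.left' two.left' x1 = -1"
    using one.boundary_conditions two.boundary_conditions slope_x1 by simp_all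
  have "1/2 * \<sigma>\<^sup>2 * mix one.left'' two.left'' x1 = 1/2 * \<sigma>\<^sup>2 * mix one.mid'' two.mid'' x1"
    using mix_ode(1) [of x1] mix_ode(3) [of x1] unfolding eq
    by (smt (verit) mult_minus1_right)
  then show ?thesis using one.\<sigma>_pos by simp
qed

lemma mid'_x2: "mix one.mid' two.mid' x2 = - c"
proof -
  have "mix one.mid' two.mid' x2 = (\<omega>\<^sub>1 + \<omega>\<^sub>2) * (- c)"
    unfolding one.boundary_conditions two.boundary_conditions by (rule distrib_right [symmetric])
  then show ?thesis by (simp add: \<omega>_sum)
qed

lemma mid_cost_x2: "mix\<delta> one.mid two.mid x2 = - \<mu> * c"
  using mix_ode(3) [of x2] unfolding mid'_x2 curvature_x2 by simp

lemma mix_curvature_pieces: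
  "mix one.curvature two.curvature x = (if x < x1 then mix one.left'' two.left'' x else
     if x < x2 then mix one.mid'' two.mid'' x else 0)"
  using curvature_x2 one.x1_less_x2
  by (auto simp: one.curvature_def two.curvature_def)

lemma mix_slope_pieces:
  "mix one.slope two.slope x = (if x < x1 then mix one.left' two.left' x else
     if x < x2 then mix one.mid' two.mid' x else - c)"
proof -
  have "\<omega>\<^sub>1 * (- c) + \<omega>\<^sub>2 * (- c) = - c"
    unfolding distrib_right [symmetric] \<omega>_sum by simp
  then show ?thesis
    by (simp add: one.slope_def two.slope_def)
qed

lemma mix_slope_deriv:
  "(mix one.slope two.slope has_real_derivative mix one.curvature two.curvature x) (at x)"
proof -
  have tail: "((\<lambda>x. if x < x2 then mix one.mid' two.mid' x else - c) has_real_derivative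
     (if x < x2 then mix one.mid'' two.mid'' x else 0)) (at x)" for x
    by (rule has_real_derivative_glue)
      (simp_all add: mid'_x2 curvature_x2 mix_deriv one.piece_derivs two.piece_derivs)
  show ?thesis unfolding mix_curvature_pieces mix_slope_pieces
    by (rule has_real_derivative_glue [OF _ tail])
      (use one.x1_less_x2 curvature_match_x1 in
        \<open>simp_all add: mix_deriv one.piece_derivs two.piece_derivs one.boundary_conditions
            two.boundary_conditions\<close>)
qed

lemma continuous_mix_curvature: "continuous_on S (mix one.curvature two.curvature)"
  unfolding mix_curvature_pieces
  by (intro continuous_on_glue)
    (use one.x1_less_x2 curvature_match_x1 curvature_x2 in
      \<open>auto intro!: continuous_intros one.continuous_pieces two.continuous_pieces\<close>)

section \<open>Strict convexity\<close>

text \<open>Differentiating the blended equation once more gives a first-order equation for the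
  curvature, driven by the derivative of the cost \<open>mix\<delta>\<close>.  That derivative is negative on the middle
  piece, and the curvature vanishes at \<^term>\<open>x2\<close>, so it is positive to the left of it.\<close>
lemma curvature_pos_mid:
  assumes "x1 \<le> x" "x < x2"
  shows "mix one.mid'' two.mid'' x > 0"
proof -
  have "mix one.mid'' two.mid'' x2 * exp (\<mu> / (1/2 * \<sigma>\<^sup>2) * x2)
      < mix one.mid'' two.mid'' x * exp (\<mu> / (1/2 * \<sigma>\<^sup>2) * x)"
  proof (rule weighted_strict_mono [OF _ assms(2)])
    show "(mix one.mid'' two.mid'' has_real_derivative mix one.mid''' two.mid''' y) (at y)" for y
      by (intro mix_deriv one.piece_derivs two.piece_derivs)
    fix y assume y: "x < y" "y < x2"
    show "1/2 * \<sigma>\<^sup>2 * mix one.mid''' two.mid''' y + \<mu> * mix one.mid'' two.mid'' y < 0"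
      unfolding mix_ode using assms y by (intro mix_neg one.mid'_neg two.mid'_neg) auto
  qed (use one.\<sigma>_pos in auto)
  then show ?thesis by (simp add: curvature_x2 zero_less_mult_iff)
qed

lemma curvature_pos_x1: "mix one.left'' two.left'' x1 > 0"
  using curvature_pos_mid [of x1] one.x1_less_x2 curvature_match_x1 by simp

lemma curvature_pos_if_cost_decreasing:
  assumes "y \<le> x1" and "\<And>x. y \<le> x \<Longrightarrow> x \<le> x1 \<Longrightarrow> mix\<delta> one.left' two.left' x \<le> 0"
  shows "mix one.left'' two.left'' y > 0"
proof -
  have "mix one.left'' two.left'' x1 * exp ((\<mu> + M) / (1/2 * \<sigma>\<^sup>2) * x1)
      \<le> mix one.left'' two.left'' y * exp ((\<mu> + M) / (1/2 * \<sigma>\<^sup>2) * y)"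
  proof (rule weighted_mono [OF _ assms(1)])
    show "(mix one.left'' two.left'' has_real_derivative mix one.left''' two.left''' y) (at y)" for y
      by (intro mix_deriv one.piece_derivs two.piece_derivs)
    fix x assume "y \<le> x" "x \<le> x1"
    then show "1/2 * \<sigma>\<^sup>2 * mix one.left''' two.left''' x + (\<mu> + M) * mix one.left'' two.left'' x \<le> 0"
      unfolding mix_ode by (rule assms(2))
  qed (use one.\<sigma>_pos in auto)
  then show ?thesis
    by (rule exp_weighted_pos [rotated]) (use curvature_pos_x1 in simp)
qed

lemma \<theta>2_mono: "one.\<theta> 2 \<le> two.\<theta> 2"
  unfolding theta_char_root using one.\<sigma>_pos \<delta>_less by (intro char_root_mono) auto

text \<open>With these signs only \<open>b'\<close>, the coefficient of the fastest decaying exponential, may be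
  positive.  Dividing by that exponential leaves a constant plus nonincreasing terms, so the blend
  changes sign at most once, from positive to negative.\<close>
lemma weighted_antimono:
  assumes "a \<le> 0" "b \<le> 0" "a' \<le> 0" "x \<le> y"
  shows "mix (exp_pair (one.\<theta> 1) (one.\<theta> 2) a b) (exp_pair (two.\<theta> 1) (two.\<theta> 2) a' b') y
           * exp (two.\<theta> 2 * y)
       \<le> mix (exp_pair (one.\<theta> 1) (one.\<theta> 2) a b) (exp_pair (two.\<theta> 1) (two.\<theta> 2) a' b') x
           * exp (two.\<theta> 2 * x)"
proof -
  have w: "mix (exp_pair (one.\<theta> 1) (one.\<theta> 2) a b) (exp_pair (two.\<theta> 1) (two.\<theta> 2) a' b') z
           * exp (two.\<theta> 2 * z)
     = \<omega>\<^sub>1 * (a * exp ((two.\<theta> 2 + one.\<theta> 1) * z) + b * exp ((two.\<theta> 2 - one.\<theta> 2) * z))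
     + \<omega>\<^sub>2 * (a' * exp ((two.\<theta> 2 + two.\<theta> 1) * z) + b')" for z
    unfolding distrib_right mult.assoc exp_pair_weighted by simp
  show ?thesis
    unfolding w using assms \<omega>_pos \<theta>2_mono one.\<theta>_pos two.\<theta>_pos
    by (intro add_mono mult_left_mono mult_left_mono_neg) (auto intro!: mult_left_mono)
qed

text \<open>The unknown signs of the coefficients \<open>A 2\<close> decide.  If both are nonnegative, the cost is
  decreasing and the previous argument applies.  If only the first is negative, the curvature itself
  changes sign at most once and is positive at \<^term>\<open>x1\<close>.  If the second is negative, the cost \<open>K\<close>
  may increase before it decreases; it starts from zero, so it never drops below its value
  \<^term>\<open>- \<mu> * c\<close> at \<^term>\<open>x2\<close>.  This bound on the cost determines the sign of the curvature
  at the origin, and the curvature, weighted by the integrating factor, rises while \<open>K\<close> rises and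
  falls while \<open>K\<close> falls.  Being positive at \<open>0\<close> and at \<^term>\<open>x1\<close>, it is positive in between.\<close>
lemma curvature_pos_left:
  assumes "0 \<le> y" "y \<le> x1"
  shows "mix one.left'' two.left'' y > 0"
proof -
  have A1: "one.\<theta> 1 * one.A 1 < 0" "two.\<theta> 1 * two.A 1 < 0"
    by (rule mult_pos_neg one.\<theta>_pos one.A1_neg two.\<theta>_pos two.A1_neg)+
  with one.\<theta>_pos(1) two.\<theta>_pos(1)
  have A1': "one.\<theta> 1 * (one.\<theta> 1 * one.A 1) < 0" "two.\<theta> 1 * (two.\<theta> 1 * two.A 1) < 0"
    by (blast intro: mult_pos_neg)+
  have sgn: "- t * a \<le> 0" if "a \<ge> 0" "t > 0" for t a :: real
    using that by simp
  have sgn': "- t * (- t * a) \<le> 0" if "a \<le> 0" "t > 0" for t a :: real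
    using that by (simp add: mult_le_0_iff)
  note sgns = sgn [OF _ one.\<theta>_pos(2)] sgn [OF _ two.\<theta>_pos(2)]
    sgn' [OF _ one.\<theta>_pos(2)] sgn' [OF _ two.\<theta>_pos(2)]
  have neg: "exp_pair p q a b x < 0" if "a < 0" "b \<le> 0" for p q a b x
    unfolding exp_pair_def using that by (intro add_neg_nonpos mult_neg_pos mult_nonpos_nonneg) auto
  consider (both) "one.A 2 \<ge> 0" "two.A 2 \<ge> 0" | (first) "one.A 2 \<le> 0" "two.A 2 \<ge> 0"
    | (second) "two.A 2 \<le> 0" by linarith
  then show ?thesis
  proof cases
    case both
    have "mix\<delta> one.left' two.left' x < 0" for x
      unfolding one.left'_def two.left'_def by (rule mix_neg neg A1 sgns both)+
    then show ?thesis by (intro curvature_pos_if_cost_decreasing [OF assms(2)] less_imp_le)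
  next
    case first
    have "mix one.left'' two.left'' x1 * exp (two.\<theta> 2 * x1)
        \<le> mix one.left'' two.left'' y * exp (two.\<theta> 2 * y)"
      unfolding one.left''_def two.left''_def by (rule weighted_antimono sgns first assms less_imp_le A1')+
    then show ?thesis
      by (rule exp_weighted_pos [rotated]) (use curvature_pos_x1 in simp)
  next
    case second
    \<comment> \<open>Otherwise every term of the curvature at \<^term>\<open>x1\<close> would be nonpositive.\<close>
    have A2: "one.A 2 \<ge> 0"
    proof (rule ccontr)
      assume "\<not> one.A 2 \<ge> 0"
      then have "one.A 2 \<le> 0" by simp
      then have "mix one.left'' two.left'' x1 < 0"
        unfolding one.left''_def two.left''_def by (intro mix_neg neg A1' sgns second)
      then show False using curvature_pos_x1 by simp
    qed
    define J where "J = mix\<delta> one.left' two.left'"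
    have J_exp: "J = mix (exp_pair (one.\<theta> 1) (one.\<theta> 2) (\<delta>\<^sub>1 * (one.\<theta> 1 * one.A 1)) (\<delta>\<^sub>1 * (- one.\<theta> 2 * one.A 2)))
        (exp_pair (two.\<theta> 1) (two.\<theta> 2) (\<delta>\<^sub>2 * (two.\<theta> 1 * two.A 1)) (\<delta>\<^sub>2 * (- two.\<theta> 2 * two.A 2)))"
      unfolding J_def one.left'_def two.left'_def exp_pair_def by (simp add: fun_eq_iff algebra_simps)
    have J_anti: "J z * exp (two.\<theta> 2 * z) \<le> J x * exp (two.\<theta> 2 * x)" if "x \<le> z" for x z
      unfolding J_exp 
      by (rule weighted_antimono mult_nonneg_nonpos less_imp_le [OF one.d_pos]
          less_imp_le [OF two.d_pos] sgns A2 that less_imp_le [OF A1(1)] less_imp_le [OF A1(2)])+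
    have J_neg: "J z \<le> 0" if "J x \<le> 0" "x \<le> z" for x z
    proof -
      have "J z * exp (two.\<theta> 2 * z) \<le> 0"
        using J_anti [OF that(2)] mult_nonpos_nonneg [OF that(1) exp_ge_zero] by (rule order_trans)
      then show ?thesis by (simp add: mult_le_0_iff)
    qed
    have J_pos: "J x \<ge> 0" if "J z > 0" "x \<le> z" for x z
      using J_neg [OF _ that(2)] that(1) by linarith
    define K where "K = mix\<delta> one.left two.left"
    have K_deriv: "(K has_real_derivative J x) (at x)" for x
      unfolding K_def J_def by (intro mix_deriv one.piece_derivs two.piece_derivs)
    have K_0: "K 0 = 0"
      by (simp add: K_def one.boundary_conditions two.boundary_conditions)
    have "mix\<delta> one.mid two.mid x2 \<le> mix\<delta> one.mid two.mid x1"
    proof (rule DERIV_nonpos_imp_nonincreasing [where f = "mix\<delta> one.mid two.mid"])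
      fix x assume "x1 \<le> x" "x \<le> x2"
      then have "mix\<delta> one.mid' two.mid' x < 0"
        by (intro mix_neg one.mid'_neg two.mid'_neg)
      moreover have "(mix\<delta> one.mid two.mid has_real_derivative mix\<delta> one.mid' two.mid' x) (at x)"
        by (intro mix_deriv one.piece_derivs two.piece_derivs)
      ultimately show "\<exists>z. (mix\<delta> one.mid two.mid has_real_derivative z) (at x) \<and> z \<le> 0"
        using less_imp_le by blast
    qed (use one.x1_less_x2 in simp)
    then have K_x1: "K x1 \<ge> - \<mu> * c"
      unfolding K_def mid_cost_x2 one.boundary_conditions(2) two.boundary_conditions(2) .
    have K_ge: "K x \<ge> - \<mu> * c" if x: "0 \<le> x" "x \<le> x1" for x
    proof (cases "J x > 0")
      case True
      have "K 0 \<le> K x"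
      proof (rule DERIV_nonneg_imp_nondecreasing [OF x(1)])
        fix z assume "0 \<le> z" "z \<le> x"
        then show "\<exists>w. (K has_real_derivative w) (at z) \<and> w \<ge> 0"
          using K_deriv J_pos True by blast
      qed
      moreover have "- \<mu> * c \<le> 0" using one.\<mu>_pos one.c_pos by simp
      ultimately show ?thesis using K_0 by linarith
    next
      case False
      have "K x1 \<le> K x"
      proof (rule DERIV_nonpos_imp_nonincreasing [OF x(2)])
        fix z assume "x \<le> z" "z \<le> x1"
        then show "\<exists>w. (K has_real_derivative w) (at z) \<and> w \<le> 0"
          using K_deriv J_neg False by (meson not_less)
      qed
      then show ?thesis using K_x1 by linarith
    qed
    \<comment> \<open>The bound on \<open>K\<close> and \<^prop>\<open>c < 1\<close> give a first-order inequality for one plus the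
      slope.  It vanishes at \<^term>\<open>x1\<close>, hence is negative at \<open>0\<close>.\<close>
    define e where "e x = - (mix one.left' two.left' x + 1)" for x
    have "e x1 * exp ((\<mu> + M) / (1/2 * \<sigma>\<^sup>2) * x1) < e 0 * exp ((\<mu> + M) / (1/2 * \<sigma>\<^sup>2) * 0)"
    proof (rule weighted_strict_mono [OF _ one.x1_pos])
      show "(e has_real_derivative - mix one.left'' two.left'' x) (at x)" for x
        unfolding e_def
        by (rule derivative_eq_intros mix_deriv one.piece_derivs two.piece_derivs refl | simp)+
      fix x assume "0 < x" "x < x1"
      then have "K x \<ge> - \<mu> * c" by (intro K_ge) auto
      moreover have "\<mu> * c < \<mu>" using one.\<mu>_pos c_less_1 by simp
      ultimately have "K x + \<mu> > 0" by simp
      moreover have "1/2 * \<sigma>\<^sup>2 * (- mix one.left'' two.left'' x) + (\<mu> + M) * e x = - (K x + \<mu>)"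
        unfolding K_def mix_ode(1) [symmetric] e_def by (simp add: algebra_simps)
      ultimately show "1/2 * \<sigma>\<^sup>2 * (- mix one.left'' two.left'' x) + (\<mu> + M) * e x < 0" by simp
    qed (use one.\<sigma>_pos in auto)
    then have "mix one.left' two.left' 0 < -1"
      by (simp add: e_def slope_x1)
    then have slope_0: "(\<mu> + M) * mix one.left' two.left' 0 < (\<mu> + M) * (-1)"
      using one.\<mu>_pos one.M_pos by (intro mult_strict_left_mono) auto
    have "1/2 * \<sigma>\<^sup>2 * mix one.left'' two.left'' 0 > 0"
    proof -
      have "p > 0" if "p + q + M = k" "q < (\<mu> + M) * (-1)" "k = 0" for p q k :: real
        using that one.\<mu>_pos by simp
      from this [OF mix_ode(1)] show ?thesis using slope_0 K_0 unfolding K_def by blast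
    qed
    then have H_0: "mix one.left'' two.left'' 0 > 0"
      by (simp add: zero_less_mult_iff)
    show ?thesis
    proof (cases "J y > 0")
      case True
      have "- mix one.left'' two.left'' y * exp ((\<mu> + M) / (1/2 * \<sigma>\<^sup>2) * y)
         \<le> - mix one.left'' two.left'' 0 * exp ((\<mu> + M) / (1/2 * \<sigma>\<^sup>2) * 0)"
      proof (rule weighted_mono [OF _ assms(1)])
        show "((\<lambda>x. - mix one.left'' two.left'' x) has_real_derivative
            - mix one.left''' two.left''' x) (at x)" for x
          by (intro DERIV_minus mix_deriv one.piece_derivs two.piece_derivs)
        fix x assume "0 \<le> x" "x \<le> y"
        then have "J x \<ge> 0" using J_pos True by blast
        then show "1/2 * \<sigma>\<^sup>2 * (- mix one.left''' two.left''' x)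
            + (\<mu> + M) * (- mix one.left'' two.left'' x) \<le> 0"
          unfolding J_def mix_ode(2) [symmetric] by (simp add: algebra_simps)
      qed (use one.\<sigma>_pos in auto)
      then have "mix one.left'' two.left'' y * exp ((\<mu> + M) / (1/2 * \<sigma>\<^sup>2) * y) > 0"
        unfolding mult_minus_left mult_zero_right exp_zero mult_1_right using H_0 by linarith
      then show ?thesis by (simp add: zero_less_mult_iff)
    next
      case False
      then have "J x \<le> 0" if "y \<le> x" for x
        using J_neg [OF _ that] by linarith
      then show ?thesis
        unfolding J_def by (intro curvature_pos_if_cost_decreasing [OF assms(2)])
    qed
  qed
qed

lemma curvature_pos:
  assumes "0 \<le> x" "x < x2"
  shows "mix one.curvature two.curvature x > 0"
  unfolding mix_curvature_pieces
  using assms curvature_pos_left [of x] curvature_pos_mid [of x] by simp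

lemma slope_strict_mono:
  assumes "0 \<le> x" "x < y" "y \<le> x2"
  shows "mix one.slope two.slope x < mix one.slope two.slope y"
proof (rule DERIV_pos_imp_increasing_open [OF assms(2), where f = "mix one.slope two.slope"])
  fix z assume "x < z" "z < y"
  then have "mix one.curvature two.curvature z > 0" using assms by (intro curvature_pos) auto
  with mix_slope_deriv
  show "\<exists>w. (mix one.slope two.slope has_real_derivative w) (at z) \<and> w > 0" by blast
next
  show "continuous_on {x..y} (mix one.slope two.slope)"
    by (intro continuous_intros one.continuous_slope two.continuous_slope)
qed

lemma mix_slope_x1: "mix one.slope two.slope x1 = -1"
  unfolding mix_slope_pieces
  using one.x1_less_x2 slope_x1 one.boundary_conditions(3) two.boundary_conditions(3) by simp

lemma mix_slope_right: "x2 \<le> x \<Longrightarrow> mix one.slope two.slope x = - c"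
  unfolding mix_slope_pieces using one.x1_less_x2 by simp

lemma mix_slope_less_c: "0 \<le> x \<Longrightarrow> x < x2 \<Longrightarrow> mix one.slope two.slope x < - c"
  using slope_strict_mono [of x x2] mix_slope_right [of x2] by simp

lemma mix_slope_le_c: "0 \<le> x \<Longrightarrow> mix one.slope two.slope x \<le> - c"
  using mix_slope_less_c [of x] mix_slope_right [of x] by force

lemma mix_slope_less_1: "0 \<le> x \<Longrightarrow> x < x1 \<Longrightarrow> mix one.slope two.slope x < -1"
  using slope_strict_mono [of x x1] mix_slope_x1 one.x1_less_x2 by simp

lemma mix_slope_mono:
  assumes "0 \<le> x" "x \<le> y"
  shows "mix one.slope two.slope x \<le> mix one.slope two.slope y"
proof -
  consider "x = y" | "x < y" "y \<le> x2" | "x2 < y" using assms by linarith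
  then show ?thesis
  proof cases
    case 2
    then show ?thesis using slope_strict_mono assms by (intro less_imp_le) blast
  next
    case 3
    then show ?thesis using mix_slope_le_c [OF assms(1)] mix_slope_right [of y] by simp
  qed simp
qed

lemma mix_slope_ge_1: "x1 \<le> x \<Longrightarrow> mix one.slope two.slope x \<ge> -1"
  using mix_slope_mono [of x1 x] mix_slope_x1 one.x1_pos by simp

lemma mix_v_deriv: "(mix one.v two.v has_real_derivative mix one.slope two.slope x) (at x within S)"
  by (rule has_field_derivative_at_within) (intro mix_deriv one.V_comp_deriv two.V_comp_deriv)

lemma mix_v_strict_antimono: "strict_antimono_on {0..} (mix one.v two.v)"
proof (rule monotone_onI)
  fix x y :: real assume xy: "x \<in> {0..}" "y \<in> {0..}" "x < y"
  show "mix one.v two.v y < mix one.v two.v x"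
  proof (rule DERIV_neg_imp_decreasing [OF xy(3), where f = "mix one.v two.v"])
    fix z assume "x \<le> z" "z \<le> y"
    then have "mix one.slope two.slope z < 0"
      using xy mix_slope_le_c [of z] one.c_pos by simp
    with mix_v_deriv [of z UNIV]
    show "\<exists>w. (mix one.v two.v has_real_derivative w) (at z) \<and> w < 0" by blast
  qed
qed

lemma convex_mix_v: "convex_on {0..} (mix one.v two.v)"
proof (rule convex_on_realI [where f' = "mix one.slope two.slope"])
  show "connected {0::real..}" by (rule connected_Ici)
next
  show "(mix one.v two.v has_real_derivative mix one.slope two.slope x) (at x)" for x
    by (rule mix_v_deriv)
next
  fix x y :: real assume "x \<in> {0..}" "x \<le> y"
  then show "mix one.slope two.slope x \<le> mix one.slope two.slope y"
    by (intro mix_slope_mono) simp_all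
qed

lemma mix_state_ode:
  assumes "x \<le> x2"
  shows "(\<mu> + Pi_hat M x1 x t) * mix one.slope two.slope x
     + 1/2 * \<sigma>\<^sup>2 * mix one.curvature two.curvature x + Pi_hat M x1 x t = mix\<delta> one.v two.v x"
proof -
  have swap: "X + Y + Z = Y + X + Z" for X Y Z :: real by simp
  show ?thesis
    by (rule trans [OF swap mix_combine [OF
          trans [OF swap one.component_ode [OF assms]]
          trans [OF swap two.component_ode [OF assms]]]])
qed

text \<open>To the right of \<^term>\<open>x2\<close> the blend no longer solves its equation; the cost falls below the
  value at which drift and curvature balance it, which is the inequality the system asks for.\<close>
lemma cost_right:
  assumes "x2 \<le> x"
  shows "mix\<delta> one.v two.v x \<le> - \<mu> * c"
proof -
  have v: "one.v y = - c * y + one.A 5" "two.v y = - c * y + two.A 5" if "x2 \<le> y" for y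
    using that one.x1_less_x2
    unfolding one.V_comp_pieces two.V_comp_pieces one.right_def two.right_def by simp_all
  have "one.v x \<le> one.v x2" "two.v x \<le> two.v x2"
    unfolding v [OF assms] v [OF order_refl] using assms one.c_pos by simp_all
  then have "mix\<delta> one.v two.v x \<le> mix\<delta> one.v two.v x2"
    using \<omega>_pos one.d_pos two.d_pos by (intro add_mono mult_left_mono) auto
  also have "\<dots> = mix\<delta> one.mid two.mid x2"
    using one.x1_less_x2 one.boundary_conditions(4) two.boundary_conditions(4)
    unfolding one.V_comp_pieces two.V_comp_pieces by simp
  finally show ?thesis unfolding mid_cost_x2 .
qed

section \<open>The extended system\<close>

lemma V_derivs_blend:
  assumes V: "\<And>x. x \<ge> 0 \<Longrightarrow> V x = mix one.v two.v x"
  shows "V_derivs (\<lambda>x t. V x) (\<lambda>x t. 0) (\<lambda>x t. mix one.slope two.slope x)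
           (\<lambda>x t. mix one.curvature two.curvature x)"
proof -
  have fst: "continuous_on state_dom (\<lambda>(x, t). F x)" if "continuous_on UNIV F" for F :: "real \<Rightarrow> real"
    unfolding case_prod_unfold
    by (rule continuous_on_compose2 [OF that]) (auto intro: continuous_intros)
  have "continuous_on state_dom (\<lambda>(x, t). V x) \<longleftrightarrow> continuous_on state_dom (\<lambda>(x, t). mix one.v two.v x)"
    by (rule continuous_on_cong) (auto simp: state_dom_def V)
  moreover have "continuous_on state_dom (\<lambda>(x, t). mix one.v two.v x)"
    by (intro fst continuous_intros one.continuous_v two.continuous_v)
  moreover have "continuous_on state_dom (\<lambda>(x, t). mix one.slope two.slope x)"
    by (intro fst continuous_intros one.continuous_slope two.continuous_slope)
  moreover have "continuous_on state_dom (\<lambda>(x, t). mix one.curvature two.curvature x)"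
    by (intro fst continuous_mix_curvature)
  moreover have "(V has_real_derivative mix one.slope two.slope x) (at x within {0..})"
    if "x \<ge> 0" for x
    by (rule has_real_derivative_cong_on [OF mix_v_deriv]) (use that V in auto)
  ultimately show ?thesis
    unfolding V_derivs_def
    by (auto simp: state_dom_def case_prod_unfold
        intro: has_field_derivative_at_within [OF mix_slope_deriv])
qed

text \<open>The auxiliary function and its derivatives weight each component by its own discount
  factor \<^term>\<open>exp (- \<delta>\<^sub>1 * (t - s))\<close> or \<^term>\<open>exp (- \<delta>\<^sub>2 * (t - s))\<close>.\<close>
definition disc :: "(real \<Rightarrow> real) \<Rightarrow> (real \<Rightarrow> real) \<Rightarrow> real \<Rightarrow> real \<Rightarrow> real \<Rightarrow> real" where
  "disc F G x t s = \<omega>\<^sub>1 * exp (- \<delta>\<^sub>1 * (t - s)) * F x + \<omega>\<^sub>2 * exp (- \<delta>\<^sub>2 * (t - s)) * G x"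

lemma disc_diag: "disc F G x t t = mix F G x"
  by (simp add: disc_def)

lemma continuous_on_disc:
  assumes "continuous_on T F" "continuous_on T G" "\<And>x t s. (x, t, s) \<in> S \<Longrightarrow> x \<in> T"
  shows "continuous_on S (\<lambda>(x, t, s). disc F G x t s)"
proof -
  have "continuous_on S (\<lambda>p. F (fst p))" "continuous_on S (\<lambda>p. G (fst p))"
    using assms by (auto intro!: continuous_on_compose2 [of T _ S fst] continuous_intros)
  then show ?thesis
    unfolding disc_def case_prod_unfold by (intro continuous_intros)
qed

lemma disc_deriv_x:
  assumes "(F has_real_derivative F' x) (at x within S)" "(G has_real_derivative G' x) (at x within S)"
  shows "((\<lambda>y. disc F G y t s) has_real_derivative disc F' G' x t s) (at x within S)"
  unfolding disc_def by (intro DERIV_add DERIV_cmult assms)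

lemma disc_deriv_time:
  "((\<lambda>r. disc F G x r s) has_real_derivative
     disc (\<lambda>x. - \<delta>\<^sub>1 * F x) (\<lambda>x. - \<delta>\<^sub>2 * G x) x t s) (at t within S)"
  "((\<lambda>r. disc F G x t r) has_real_derivative
     disc (\<lambda>x. \<delta>\<^sub>1 * F x) (\<lambda>x. \<delta>\<^sub>2 * G x) x t s) (at s within S')"
  unfolding disc_def by (rule derivative_eq_intros refl | simp add: algebra_simps)+

lemma f_derivs_blend:
  assumes f: "\<And>x t s. x \<ge> 0 \<Longrightarrow> t \<ge> 0 \<Longrightarrow> s \<in> {0..t} \<Longrightarrow> f x t s = disc one.v two.v x t s"
  shows "f_derivs x1 x2 f (disc (\<lambda>x. - \<delta>\<^sub>1 * one.v x) (\<lambda>x. - \<delta>\<^sub>2 * two.v x))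
           (disc (\<lambda>x. \<delta>\<^sub>1 * one.v x) (\<lambda>x. \<delta>\<^sub>2 * two.v x))
           (disc one.slope two.slope) (disc one.curvature two.curvature)"
proof -
  note cont = continuous_on_disc [OF _ _ UNIV_I] one.continuous_v two.continuous_v
    one.continuous_slope two.continuous_slope continuous_intros
  have "continuous_on f_dom (\<lambda>(x, t, s). disc one.v two.v x t s)"
    by (intro cont)
  then have cont_f: "continuous_on f_dom (\<lambda>(x, t, s). f x t s)"
    by (rule continuous_on_eq) (auto simp: f_dom_def f)
  have cont_ft:
    "continuous_on f_dom (\<lambda>(x, t, s). disc (\<lambda>x. - \<delta>\<^sub>1 * one.v x) (\<lambda>x. - \<delta>\<^sub>2 * two.v x) x t s)"
    by (intro cont)
  have cont_fs:
    "continuous_on f_dom (\<lambda>(x, t, s). disc (\<lambda>x. \<delta>\<^sub>1 * one.v x) (\<lambda>x. \<delta>\<^sub>2 * two.v x) x t s)"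
    by (intro cont)
  have cont_fx: "continuous_on f_dom (\<lambda>(x, t, s). disc one.slope two.slope x t s)"
    by (intro cont)
  have deriv_t: "((\<lambda>r. f x r s) has_real_derivative
       disc (\<lambda>x. - \<delta>\<^sub>1 * one.v x) (\<lambda>x. - \<delta>\<^sub>2 * two.v x) x t s) (at t within {s..})"
    if "(x, t, s) \<in> f_dom" for x t s
    by (rule has_real_derivative_cong_on [OF disc_deriv_time(1)])
      (use that f in \<open>auto simp: f_dom_def\<close>)
  have deriv_s: "((\<lambda>r. f x t r) has_real_derivative
       disc (\<lambda>x. \<delta>\<^sub>1 * one.v x) (\<lambda>x. \<delta>\<^sub>2 * two.v x) x t s) (at s within {0..t})"
    if "(x, t, s) \<in> f_dom" for x t s
    by (rule has_real_derivative_cong_on [OF disc_deriv_time(2)])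
      (use that f in \<open>auto simp: f_dom_def\<close>)
  have deriv_x: "((\<lambda>y. f y t s) has_real_derivative disc one.slope two.slope x t s) (at x within {0..})"
    if "(x, t, s) \<in> f_dom" for x t s
  proof (rule has_real_derivative_cong_on)
    show "((\<lambda>y. disc one.v two.v y t s) has_real_derivative disc one.slope two.slope x t s)
        (at x within {0..})"
      by (rule has_field_derivative_at_within) (intro disc_deriv_x one.V_comp_deriv two.V_comp_deriv)
  qed (use that f in \<open>auto simp: f_dom_def\<close>)
  have deriv_xx: "((\<lambda>y. disc one.slope two.slope y t s) has_real_derivative
       disc one.curvature two.curvature x t s) (at x within {0..})"
    if "x \<noteq> x1 \<and> x \<noteq> x2" for x t s
    by (rule has_field_derivative_at_within) (use that in \<open>intro disc_deriv_x one.slope_deriv two.slope_deriv; blast\<close>)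
  have "continuous_on {..<x1} one.curvature" "continuous_on {..<x1} two.curvature"
    by (rule continuous_on_eq [OF one.continuous_pieces(1)] continuous_on_eq [OF two.continuous_pieces(1)],
        simp add: one.curvature_def two.curvature_def)+
  then have fxx_left: "continuous_on (f_dom \<inter> {(x, t, s). x < x1})
      (\<lambda>(x, t, s). disc one.curvature two.curvature x t s)"
    by (rule continuous_on_disc) auto
  have "continuous_on {x1..x2} one.curvature" "continuous_on {x1..x2} two.curvature"
    by (rule continuous_on_eq [OF one.continuous_pieces(2)] continuous_on_eq [OF two.continuous_pieces(2)],
        simp add: one.curvature_def two.curvature_def)+
  then have fxx_mid: "continuous_on (f_dom \<inter> {(x, t, s). x1 \<le> x \<and> x \<le> x2})
      (\<lambda>(x, t, s). disc one.curvature two.curvature x t s)"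
    by (rule continuous_on_disc) auto
  have "continuous_on {x2<..} one.curvature" "continuous_on {x2<..} two.curvature"
    by (rule continuous_on_eq [OF continuous_on_const [of _ 0]],
        use one.x1_less_x2 in \<open>simp add: one.curvature_def two.curvature_def\<close>)+
  then have fxx_right: "continuous_on (f_dom \<inter> {(x, t, s). x2 < x})
      (\<lambda>(x, t, s). disc one.curvature two.curvature x t s)"
    by (rule continuous_on_disc) auto
  have lim_left: "\<exists>l. ((\<lambda>y. disc one.curvature two.curvature y t s) \<longlongrightarrow> l) (at_left x1)" for t s
  proof -
    have "continuous_on UNIV (\<lambda>y. disc one.left'' two.left'' y t s)"
      unfolding disc_def by (intro continuous_intros one.continuous_pieces two.continuous_pieces)
    then have "((\<lambda>y. disc one.left'' two.left'' y t s) \<longlongrightarrow> disc one.left'' two.left'' x1 t s) (at_left x1)"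
      unfolding continuous_on_def by (meson UNIV_I subset_UNIV tendsto_within_subset)
    moreover have "\<forall>\<^sub>F y in at_left x1.
        disc one.left'' two.left'' y t s = disc one.curvature two.curvature y t s"
      unfolding eventually_at_filter
      by (auto simp: disc_def one.curvature_def two.curvature_def)
    ultimately show ?thesis by - (rule exI, erule (1) Lim_transform_eventually)
  qed
  have lim_right: "\<exists>l. ((\<lambda>y. disc one.curvature two.curvature y t s) \<longlongrightarrow> l) (at_right x2)" for t s
  proof -
    have "\<forall>\<^sub>F y in at_right x2. 0 = disc one.curvature two.curvature y t s"
      unfolding eventually_at_filter using one.x1_less_x2
      by (auto simp: disc_def one.curvature_def two.curvature_def)
    then show ?thesis by - (rule exI, erule Lim_transform_eventually [OF tendsto_const])
  qed
  show ?thesis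
    unfolding f_derivs_def
    by (intro conjI allI impI cont_f cont_ft cont_fs cont_fx fxx_left fxx_mid fxx_right lim_left lim_right)
      (clarify, intro conjI impI deriv_t deriv_s deriv_x deriv_xx; blast)
qed

text \<open>On \<^term>\<open>{..x2}\<close> each component solves its own linear equation, and the separate discount
  factors absorb the time derivative.\<close>
lemma disc_ode:
  assumes "x \<le> x2"
  shows "disc (\<lambda>x. - \<delta>\<^sub>1 * one.v x) (\<lambda>x. - \<delta>\<^sub>2 * two.v x) x t s
     + (\<mu> + Pi_hat M x1 x t) * disc one.slope two.slope x t s
     + 1/2 * \<sigma>\<^sup>2 * disc one.curvature two.curvature x t s
     + (\<omega>\<^sub>1 * exp (- \<delta>\<^sub>1 * (t - s)) + \<omega>\<^sub>2 * exp (- \<delta>\<^sub>2 * (t - s))) * Pi_hat M x1 x t = 0"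
proof -
  have "disc (\<lambda>x. - \<delta>\<^sub>1 * one.v x) (\<lambda>x. - \<delta>\<^sub>2 * two.v x) x t s
      = - (\<omega>\<^sub>1 * exp (- \<delta>\<^sub>1 * (t - s)) * (\<delta>\<^sub>1 * one.v x)
         + \<omega>\<^sub>2 * exp (- \<delta>\<^sub>2 * (t - s)) * (\<delta>\<^sub>2 * two.v x))"
    by (simp add: disc_def)
  also have "\<dots> = - (\<omega>\<^sub>1 * exp (- \<delta>\<^sub>1 * (t - s)) * ((\<mu> + Pi_hat M x1 x t) * one.slope x
           + 1/2 * \<sigma>\<^sup>2 * one.curvature x + Pi_hat M x1 x t)
         + \<omega>\<^sub>2 * exp (- \<delta>\<^sub>2 * (t - s)) * ((\<mu> + Pi_hat M x1 x t) * two.slope x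
           + 1/2 * \<sigma>\<^sup>2 * two.curvature x + Pi_hat M x1 x t))"
    unfolding one.component_ode [OF assms] two.component_ode [OF assms] ..
  finally show ?thesis
    unfolding disc_def [of one.slope] disc_def [of one.curvature] by (simp add: algebra_simps)
qed

lemma blend_solves_extended_HJB:
  assumes V: "\<And>x. x \<ge> 0 \<Longrightarrow> V x = mix one.v two.v x"
    and f: "\<And>x t s. x \<ge> 0 \<Longrightarrow> t \<ge> 0 \<Longrightarrow> s \<in> {0..t} \<Longrightarrow> f x t s = disc one.v two.v x t s"
    and \<beta>: "\<And>t. t \<ge> 0 \<Longrightarrow> \<beta> t = \<omega>\<^sub>1 * exp (- \<delta>\<^sub>1 * t) + \<omega>\<^sub>2 * exp (- \<delta>\<^sub>2 * t)"
  shows "extended_HJB_solution \<mu> \<sigma> M c \<beta> x1 x2 f (\<lambda>x t. V x)"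
proof -
  define Vx Vxx D where "Vx = mix one.slope two.slope"
    and "Vxx = mix one.curvature two.curvature" and "D = mix\<delta> one.v two.v"
  define ft fs fx fxx where "ft = disc (\<lambda>x. - \<delta>\<^sub>1 * one.v x) (\<lambda>x. - \<delta>\<^sub>2 * two.v x)"
    and "fs = disc (\<lambda>x. \<delta>\<^sub>1 * one.v x) (\<lambda>x. \<delta>\<^sub>2 * two.v x)"
    and "fx = disc one.slope two.slope" and "fxx = disc one.curvature two.curvature"
  have fs: "fs x t t = D x" for x t by (simp add: fs_def D_def disc_diag)
  have pi_min: "is_arg_min (\<lambda>u. 0 + (\<mu> + u) * Vx x + 1/2 * \<sigma>\<^sup>2 * Vxx x + u - fs x t t)
      (\<lambda>u. u \<in> {0..M}) (Pi_hat M x1 x t)" if "x \<ge> 0" for x t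
  proof -
    \<comment> \<open>The expression is affine in the control, so the sign of one plus the slope decides.\<close>
    have split: "0 + (\<mu> + u) * Vx x + 1/2 * \<sigma>\<^sup>2 * Vxx x + u - fs x t t
        = (\<mu> * Vx x + 1/2 * \<sigma>\<^sup>2 * Vxx x - fs x t t) + u * (1 + Vx x)" for u
      by (simp add: algebra_simps)
    have "Pi_hat M x1 x t * (1 + Vx x) \<le> u * (1 + Vx x)" if u: "u \<in> {0..M}" for u
    proof (cases "x < x1")
      case True
      then have "1 + Vx x \<le> 0" using mix_slope_less_1 [OF \<open>x \<ge> 0\<close>] unfolding Vx_def by simp
      then show ?thesis using True u by (auto simp: Pi_hat_def intro: mult_right_mono_neg)
    next
      case False
      then have "1 + Vx x \<ge> 0" using mix_slope_ge_1 [of x] unfolding Vx_def by simp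
      then show ?thesis using False u by (simp add: Pi_hat_def)
    qed
    moreover have "Pi_hat M x1 x t \<in> {0..M}" using one.M_pos by (simp add: Pi_hat_def)
    ultimately show ?thesis
      unfolding is_arg_min_def split by (auto simp: not_less)
  qed
  have hjb: "min (0 + (\<mu> + Pi_hat M x1 x t) * Vx x + 1/2 * \<sigma>\<^sup>2 * Vxx x + Pi_hat M x1 x t - fs x t t)
      (- c - Vx x) = 0" if "x \<ge> 0" for x t
  proof (cases "x \<le> x2")
    case True
    have "(\<mu> + Pi_hat M x1 x t) * Vx x + 1/2 * \<sigma>\<^sup>2 * Vxx x + Pi_hat M x1 x t = D x"
      unfolding Vx_def Vxx_def D_def by (rule mix_state_ode [OF True])
    moreover have "- c - Vx x \<ge> 0"
      using mix_slope_le_c [OF that] unfolding Vx_def by simp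
    ultimately show ?thesis unfolding fs by simp
  next
    case False
    then have "Vx x = - c" "Vxx x = 0" "D x \<le> - \<mu> * c" "Pi_hat M x1 x t = 0"
      using mix_slope_right [of x] cost_right [of x] one.x1_less_x2
      unfolding Vx_def Vxx_def D_def mix_curvature_pieces Pi_hat_def by auto
    then show ?thesis unfolding fs by simp
  qed
  have closure: "x \<le> x2"
    if "(x, t) \<in> closure {(x, t). (x, t) \<in> state_dom \<and> - c - Vx x > 0}" for x t
  proof -
    have "x < x2" if "- c - Vx x > 0" for x
      using mix_slope_right [of x] that unfolding Vx_def by force
    then have "{(x, t). (x, t) \<in> state_dom \<and> - c - Vx x > 0} \<subseteq> {..x2} \<times> {0..}"
      by (auto simp: state_dom_def less_imp_le)
    then have "closure {(x, t). (x, t) \<in> state_dom \<and> - c - Vx x > 0} \<subseteq> {..x2} \<times> {0..}"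
      by (rule closure_minimal) (intro closed_Times closed_atMost closed_atLeast)
    then show ?thesis using that by auto
  qed
  have pde: "ft x t s + (\<mu> + Pi_hat M x1 x t) * fx x t s + 1/2 * \<sigma>\<^sup>2 * fxx x t s
      + \<beta> (t - s) * Pi_hat M x1 x t = 0" if "x \<le> x2" "s \<in> {0..t}" for x t s
  proof -
    have "\<beta> (t - s) = \<omega>\<^sub>1 * exp (- \<delta>\<^sub>1 * (t - s)) + \<omega>\<^sub>2 * exp (- \<delta>\<^sub>2 * (t - s))"
      using that \<beta> by simp
    then show ?thesis using disc_ode [OF that(1)] unfolding ft_def fx_def fxx_def by simp
  qed
  have inject: "- \<beta> (t - s) * c - fx x t s = 0"
    if "x \<ge> 0" "- c - Vx x = 0" "s \<in> {0..t}" for x t s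
  proof -
    have "x \<ge> x2"
      using mix_slope_less_c [OF that(1)] that(2) unfolding Vx_def by force
    \<comment> \<open>There the components satisfy the condition one by one, whatever their discount factors.\<close>
    then have "one.slope x = - c" "two.slope x = - c"
      using one.x1_less_x2 by (simp_all add: one.slope_def two.slope_def)
    then show ?thesis
      using \<beta> [of "t - s"] that(3) by (simp add: fx_def disc_def algebra_simps)
  qed
  have VD: "V_derivs (\<lambda>x t. V x) (\<lambda>x t. 0) (\<lambda>x t. Vx x) (\<lambda>x t. Vxx x)"
    unfolding Vx_def Vxx_def using V by (rule V_derivs_blend)
  have fD: "f_derivs x1 x2 f ft fs fx fxx"
    unfolding ft_def fs_def fx_def fxx_def using f by (rule f_derivs_blend)
  have 0: "V 0 = 0" "\<And>t s. t \<ge> 0 \<Longrightarrow> s \<in> {0..t} \<Longrightarrow> f 0 t s = 0"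
    by (simp_all add: V f disc_def one.V_comp_0 two.V_comp_0)
  show ?thesis
    unfolding extended_HJB_solution_def Let_def
  proof (intro exI conjI)
    show "V_derivs (\<lambda>x t. V x) (\<lambda>x t. 0) (\<lambda>x t. Vx x) (\<lambda>x t. Vxx x)" by (rule VD)
    show "f_derivs x1 x2 f ft fs fx fxx" by (rule fD)
    show "\<forall>(x, t)\<in>state_dom. is_arg_min
        (\<lambda>u. 0 + (\<mu> + u) * Vx x + 1/2 * \<sigma>\<^sup>2 * Vxx x + u - fs x t t) (\<lambda>u. u \<in> {0..M}) (Pi_hat M x1 x t)"
      by (clarify, rule pi_min) (simp add: state_dom_def)
    show "\<forall>(x, t)\<in>state_dom. min (0 + (\<mu> + Pi_hat M x1 x t) * Vx x + 1/2 * \<sigma>\<^sup>2 * Vxx x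
        + Pi_hat M x1 x t - fs x t t) (- c - Vx x) = 0"
      by (clarify, rule hjb) (simp add: state_dom_def)
    show "\<forall>t\<ge>0. V 0 = 0" using 0 by blast
    show "\<forall>(x, t)\<in>closure {(x, t). (x, t) \<in> state_dom \<and> 0 < - c - Vx x}. \<forall>s\<in>{0..t}.
        ft x t s + (\<mu> + Pi_hat M x1 x t) * fx x t s + 1/2 * \<sigma>\<^sup>2 * fxx x t s
          + \<beta> (t - s) * Pi_hat M x1 x t = 0"
      by (clarify, rule pde) (use closure in blast)+
    show "\<forall>(x, t)\<in>{(x, t). (x, t) \<in> state_dom \<and> - c - Vx x = 0}. \<forall>s\<in>{0..t}.
        - \<beta> (t - s) * c - fx x t s = 0"
      by (clarify, rule inject) (auto simp: state_dom_def)
    show "\<forall>t\<ge>0. \<forall>s\<in>{0..t}. f 0 t s = 0" using 0 by blast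
  qed
qed

end

theorem proposition5p2:
  fixes \<mu> \<sigma> M c x1 x2 :: real
    and \<omega> \<delta> :: "nat \<Rightarrow> real"
    and \<beta> V :: "real \<Rightarrow> real"
    and f :: "real \<Rightarrow> real \<Rightarrow> real \<Rightarrow> real"
    and A \<theta> :: "nat \<Rightarrow> nat \<Rightarrow> real"
  assumes "\<mu> > 0" "\<sigma> > 0" "M > 0" "0 < c" "c < 1"
    and "\<omega> 1 > 0" "\<omega> 2 > 0" "\<omega> 1 + \<omega> 2 = 1"
    and "0 < \<delta> 1" "\<delta> 1 < \<delta> 2"
    and "\<And>t. t \<ge> 0 \<Longrightarrow> \<beta> t = (\<Sum>i=1..2. \<omega> i * exp (- \<delta> i * t))"
    and "0 < x1" "x1 < x2"
    and "A = (\<lambda>i. A_coeff \<mu> \<sigma> M c (\<delta> i) x1 x2)"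
    and "\<theta> = (\<lambda>i. theta \<mu> \<sigma> M (\<delta> i))"
    and "(\<Sum>i=1..2. \<omega> i * (A i 1 * \<theta> i 1 * exp (\<theta> i 1 * x1)
                          - A i 2 * \<theta> i 2 * exp (- \<theta> i 2 * x1))) = -1"
    and "(\<Sum>i=1..2. \<omega> i * (A i 3 * (\<theta> i 3)\<^sup>2 * exp (\<theta> i 3 * x2)
                          + A i 4 * (\<theta> i 4)\<^sup>2 * exp (- \<theta> i 4 * x2))) = 0"
    and "\<And>x t s. x \<ge> 0 \<Longrightarrow> t \<ge> 0 \<Longrightarrow> s \<in> {0..t} \<Longrightarrow>
           f x t s = (\<Sum>i=1..2. \<omega> i * exp (- \<delta> i * (t - s)) * V_comp \<mu> \<sigma> M c (\<delta> i) x1 x2 x)"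
    and "\<And>x. x \<ge> 0 \<Longrightarrow> V x = (\<Sum>i=1..2. \<omega> i * V_comp \<mu> \<sigma> M c (\<delta> i) x1 x2 x)"
  shows "extended_HJB_solution \<mu> \<sigma> M c \<beta> x1 x2 f (\<lambda>x t. V x)
       \<and> strict_antimono_on {0..} V \<and> convex_on {0..} V"
proof -
  have sum2: "(\<Sum>i = 1..2. g i) = g 1 + g 2" for g :: "nat \<Rightarrow> real"
    by (simp add: numeral_2_eq_2)
  note A_eq = \<open>A = _\<close> and \<theta>_eq = \<open>\<theta> = _\<close>
  interpret one: component \<mu> \<sigma> M c "\<delta> 1" x1 x2
    by unfold_locales (fact assms)+
  interpret two: component \<mu> \<sigma> M c "\<delta> 2" x1 x2
    by unfold_locales (use assms in linarith)+
  have slope: "\<omega> 1 * one.left' x1 + \<omega> 2 * two.left' x1 = -1"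
    using assms(16) unfolding sum2 A_eq \<theta>_eq one.left'_def two.left'_def exp_pair_def
    by (simp add: mult_ac)
  have curvature: "\<omega> 1 * one.mid'' x2 + \<omega> 2 * two.mid'' x2 = 0"
    using assms(17) unfolding sum2 A_eq \<theta>_eq one.mid''_def two.mid''_def exp_pair_def
    by (simp add: mult_ac power2_eq_square)
  interpret equilibrium \<mu> \<sigma> M c "\<delta> 1" "\<delta> 2" x1 x2 "\<omega> 1" "\<omega> 2"
    by unfold_locales (fact slope curvature assms)+
  have V: "V x = \<omega> 1 * one.v x + \<omega> 2 * two.v x" if "x \<ge> 0" for x
    using assms(19) [OF that] unfolding sum2 .
  have "f x t s = disc one.v two.v x t s" if "x \<ge> 0" "t \<ge> 0" "s \<in> {0..t}" for x t s
    using assms(18) [OF that] unfolding sum2 disc_def .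
  moreover have "\<beta> t = \<omega> 1 * exp (- \<delta> 1 * t) + \<omega> 2 * exp (- \<delta> 2 * t)" if "t \<ge> 0" for t
    using assms(11) [OF that] unfolding sum2 .
  ultimately have "extended_HJB_solution \<mu> \<sigma> M c \<beta> x1 x2 f (\<lambda>x t. V x)"
    using V by (intro blend_solves_extended_HJB)
  moreover have "strict_antimono_on {0..} V"
    using mix_v_strict_antimono V by (auto simp: monotone_on_def)
  moreover have "convex_on {0..} V"
    using convex_mix_v V by (auto simp: convex_on_def)
  ultimately show ?thesis by blast
qed

end
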